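(* Let $A$ be a commutative algebra over $\mathbb{C}$, let $Y$ be a pointed simplicial finite set, let $N\geq 2$ and let $q\in\mathbb{C}$ be a primitive $N$-th root of unity. Let $D:A\longrightarrow A$ be a derivation on $A$. Then, for each $n\in\mathbb{Z}$, the derivation $D$ induces a morphism $$\underline{L}_D^{Y,n}:{}_qHH_Y^n(A,A)\longrightarrow{}_qHH_Y^n(A,A)$$ on the bivariant $q$-Hochschild cohomology groups of order $Y$; that is, the degree $0$ endomorphism $\underline{L}_D^Y$ of $\underline{Hom}(\mathcal{L}^Y(A),\mathcal{L}^Y(A))$ defined in the context induces a well-defined linear map on the homology objects of the $N$-complex $(\underline{Hom}(\mathcal{L}^Y(A),\mathcal{L}^Y(A)),{}_q\partial)$.
   Context: $Vect$ is the category of complex vector spaces; tensor products are over $\mathbb{C}$. A derivation on $A$ is a $\mathbb{C}$-linear map $D:A\to A$ with $D(aa')=D(a)a'+aD(a')$. $\Gamma$ is the category with objects $[n]=\{0,1,\dots,n\}$, $n\geq 0$, pointed at $0$, and morphisms the maps of sets preserving $0$. The functor $\mathcal{L}(A):\Gamma\to Vect$ sends $[n]$ to $A\otimes A^{\otimes n}$, and $\phi:[m]\to[n]$ to $\mathcal{L}(A)(\phi)(a_0\otimes\dots\otimes a_m)=b_0\otimes\dots\otimes b_n$ with $b_j=\prod_{\phi(i)=j}a_i$ (empty product $=1$). It is extended to the category $Fin_*$ of finite pointed sets by $\mathcal{L}(A)(T)=\mathrm{colim}_{\Gamma\ni T'\to T}\,\mathcal{L}(A)(T')$. A pointed simplicial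 finite set is a functor $Y:\Delta^{op}\to Fin_*$, with $\Delta$ the simplex category; $\mathcal{L}^Y(A)=\mathcal{L}(A)\circ Y:\Delta^{op}\to Vect$ is a simplicial vector space, with $i$-th component $\mathcal{L}^Y(A)_i=\mathcal{L}(A)(Y_i)$ and face maps $d_n^i:\mathcal{L}^Y(A)_n\to\mathcal{L}^Y(A)_{n-1}$, $0\leq i\leq n$. Set $\mathcal{L}^Y(A)_n=0$ for $n<0$ and ${}_qb_n=\sum_{i=0}^n q^i d_n^i:\mathcal{L}^Y(A)_n\to\mathcal{L}^Y(A)_{n-1}$ (with ${}_qb_n=0$ for $n\le 0$). It is known that ${}_qb^N=0$, i.e. $(\mathcal{L}^Y(A),{}_qb)$ is an $N$-complex (a sequence of objects and maps of degree $-1$, any $N$ consecutive ones composing to $0$). For an $N$-complex $(C_*,b)$ the homology object is $H_{\{n\}}(C_*,b)=\bigoplus_{i=1}^{N-1}H_{\{i,n\}}(C_*,b)$, where $H_{\{i,n\}}(C_*,b)=\mathrm{Ker}(b^i:C_n\to C_{n-i})/\mathrm{Im}(b^{N-i}:C_{n+N-i}\to C_n)$, $n\in\mathbb{Z}$. For $n\in\mathbb{Z}$ put $\underline{Hom}(\mathcal{L}^Y(A),\mathcal{L}^Y(A))_n=\prod_{i\in\mathbb{Z}}Hom_{Vect}(\mathcal{L}^Y(A)_i,\mathcal{L}^Y(A)_{i+n})$, and define ${}_q\partial_n:\underline{Hom}(\mathcal{L}^Y(A),\mathcal{L}^Y(A))_n\to\underline{Hom}(\mathcal{L}^Y(A),\mathcal{L}^Y(A))_{n-1}$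 on $f=\{f_i\}_{i\in\mathbb{Z}}$ by ${}_q\partial_n(f)_i={}_qb_{i+n}\circ f_i-q^n f_{i-1}\circ{}_qb_i$. It is known (Kapranov) that this is an $N$-complex. The bivariant $q$-Hochschild cohomology groups of $A$ of order $Y$ are ${}_qHH_Y^n(A,A)=H_{\{-n\}}(\underline{Hom}(\mathcal{L}^Y(A),\mathcal{L}^Y(A)),{}_q\partial)$, $n\in\mathbb{Z}$. Given a derivation $D$, define $L_D([n]):\mathcal{L}(A)([n])\to\mathcal{L}(A)([n])$ by $a_0\otimes\dots\otimes a_n\mapsto\sum_{i=0}^n a_0\otimes\dots\otimes D(a_i)\otimes\dots\otimes a_n$. For $T\in Fin_*$, $L_D(T):\mathcal{L}(A)(T)\to\mathcal{L}(A)(T)$ is the map induced on the colimit by the maps $L_D(T')$, $T'\in\Gamma$; equivalently $L_D(T)=\mathcal{L}(A)(\sigma)\circ L_D([m])\circ\mathcal{L}(A)(\sigma)^{-1}$ for any pointed bijection $\sigma:[m]\to T$. Put $L^Y_{D,i}=L_D(Y_i):\mathcal{L}^Y(A)_i\to\mathcal{L}^Y(A)_i$ for $i\geq 0$ and $L^Y_{D,i}=0$ for $i<0$. The endomorphism $\underline{L}_D^Y$ of $\underline{Hom}(\mathcal{L}^Y(A),\mathcal{L}^Y(A))$, of degree $0$, is given on $f\in\underline{Hom}(\mathcal{L}^Y(A),\mathcal{L}^Y(A))_n$ by $\underline{L}_D^Y(f)_i=L^Y_{D,i+n}\circ f_i-f_i\circ L^Y_{D,i}$. The map $\underline{L}_D^{Y,n}$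 is the one it induces on each summand $H_{\{i,-n\}}$. *)

theory Defs
  imports "HOL-Algebra.Algebra" "HOL-Algebra.Algebraic_Closure_Type"
begin

section \<open>Complex vector spaces\<close>

text \<open>
  An object of Vect is a record \<open>V\<close> with \<open>module complex_field V\<close>; a commutative algebra
  (unital, possibly zero) is a record \<open>A\<close> with \<open>algebra complex_field A\<close>.
\<close>

abbreviation complex_field :: "complex ring" where
  "complex_field \<equiv> ring_of_type_algebra"

text \<open>The record type \<open>module\<close> extends \<open>ring\<close>; the multiplicative part is unused in a vector space.\<close>

definition mk_vs :: "'v set \<Rightarrow> 'v \<Rightarrow> ('v \<Rightarrow> 'v \<Rightarrow> 'v) \<Rightarrow> (complex \<Rightarrow> 'v \<Rightarrow> 'v) \<Rightarrow> (complex, 'v) module" where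
  "mk_vs C z a s = \<lparr>partial_object.carrier = C, monoid.mult = undefined, monoid.one = undefined, ring.zero = z, ring.add = a, module.smult = s\<rparr>"

definition complex_vs :: "(complex, complex) module" where
  "complex_vs = mk_vs UNIV 0 (+) (*)"

definition zero_vs :: "(complex, 'v) module" where
  "zero_vs = mk_vs {undefined} undefined (\<lambda>_ _. undefined) (\<lambda>_ _. undefined)"

definition vspan :: "(complex, 'v) module \<Rightarrow> 'v set \<Rightarrow> 'v set" where
  "vspan V S = \<Inter>{H. submodule H complex_field V \<and> S \<subseteq> H}"

definition quot_vs :: "(complex, 'v) module \<Rightarrow> 'v set \<Rightarrow> (complex, 'v set) module" where
  "quot_vs V H = mk_vs (a_rcosets\<^bsub>V\<^esub> H) H (set_add V)
     (\<lambda>c K. \<Union>x\<in>K. H +>\<^bsub>V\<^esub> (c \<odot>\<^bsub>V\<^esub> x))"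

definition prod_vs :: "'i set \<Rightarrow> ('i \<Rightarrow> (complex, 'v) module) \<Rightarrow> (complex, 'i \<Rightarrow> 'v) module" where
  "prod_vs I V = mk_vs (\<Pi>\<^sub>E i\<in>I. carrier (V i)) (\<lambda>i\<in>I. \<zero>\<^bsub>V i\<^esub>)
     (\<lambda>x y. \<lambda>i\<in>I. x i \<oplus>\<^bsub>V i\<^esub> y i) (\<lambda>c x. \<lambda>i\<in>I. c \<odot>\<^bsub>V i\<^esub> x i)"

definition dsum_vs :: "'i set \<Rightarrow> ('i \<Rightarrow> (complex, 'v) module) \<Rightarrow> (complex, 'i \<Rightarrow> 'v) module" where
  "dsum_vs I V = (prod_vs I V)\<lparr>carrier :=
     {x \<in> carrier (prod_vs I V). finite {i \<in> I. x i \<noteq> \<zero>\<^bsub>V i\<^esub>}}\<rparr>"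

definition dsum_in :: "'i set \<Rightarrow> ('i \<Rightarrow> (complex, 'v) module) \<Rightarrow> 'i \<Rightarrow> 'v \<Rightarrow> 'i \<Rightarrow> 'v" where
  "dsum_in I V i x = (\<lambda>j\<in>I. if j = i then x else \<zero>\<^bsub>V j\<^esub>)"

definition lin_map ::
  "(complex, 'v) module \<Rightarrow> (complex, 'w) module \<Rightarrow> ('v \<Rightarrow> 'w) \<Rightarrow> bool" where
  "lin_map V W h \<longleftrightarrow> h \<in> carrier V \<rightarrow> carrier W \<and>
     (\<forall>x\<in>carrier V. \<forall>y\<in>carrier V. h (x \<oplus>\<^bsub>V\<^esub> y) = h x \<oplus>\<^bsub>W\<^esub> h y) \<and>
     (\<forall>c. \<forall>x\<in>carrier V. h (c \<odot>\<^bsub>V\<^esub> x) = c \<odot>\<^bsub>W\<^esub> h x)"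

text \<open>Extensionality makes equality in Hom the equality of maps on \<open>carrier V\<close>.\<close>

definition vhom :: "(complex, 'v) module \<Rightarrow> (complex, 'w) module \<Rightarrow> ('v \<Rightarrow> 'w) set" where
  "vhom V W = {h \<in> extensional (carrier V). lin_map V W h}"

definition hom_vs ::
  "(complex, 'v) module \<Rightarrow> (complex, 'w) module \<Rightarrow> (complex, 'v \<Rightarrow> 'w) module" where
  "hom_vs V W = mk_vs (vhom V W) (\<lambda>x\<in>carrier V. \<zero>\<^bsub>W\<^esub>)
     (\<lambda>f g. \<lambda>x\<in>carrier V. f x \<oplus>\<^bsub>W\<^esub> g x) (\<lambda>c f. \<lambda>x\<in>carrier V. c \<odot>\<^bsub>W\<^esub> f x)"

text \<open>The linear map \<open>V \<rightarrow> W\<close> determined by \<open>gen x \<mapsto> val x\<close>, where the \<open>gen x\<close> with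
  \<open>x \<in> S\<close> span \<open>V\<close>.\<close>

definition lin_ext :: "(complex, 'v) module \<Rightarrow> (complex, 'w) module \<Rightarrow> 'x set \<Rightarrow>
    ('x \<Rightarrow> 'v) \<Rightarrow> ('x \<Rightarrow> 'w) \<Rightarrow> 'v \<Rightarrow> 'w" where
  "lin_ext V W S gen val = (THE h. h \<in> vhom V W \<and> (\<forall>x\<in>S. h (gen x) = val x))"

definition is_derivation :: "(complex, 'a) module \<Rightarrow> ('a \<Rightarrow> 'a) \<Rightarrow> bool" where
  "is_derivation A D \<longleftrightarrow> lin_map A A D \<and>
     (\<forall>a\<in>carrier A. \<forall>b\<in>carrier A. D (a \<otimes>\<^bsub>A\<^esub> b) = D a \<otimes>\<^bsub>A\<^esub> b \<oplus>\<^bsub>A\<^esub> a \<otimes>\<^bsub>A\<^esub> D b)"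

section \<open>Tensor powers\<close>

text \<open>\<open>tpow A I\<close> is the tensor product of copies of \<open>A\<close> indexed by \<open>I\<close>: the free vector space on
  the families \<open>I \<rightarrow> A\<close> modulo the multilinearity relations; \<open>pure_tensor A I a\<close> is the class of the
  basis vector at the family \<open>a\<close>.\<close>

definition free_vs :: "'x set \<Rightarrow> (complex, 'x \<Rightarrow> complex) module" where
  "free_vs S = dsum_vs S (\<lambda>_. complex_vs)"

definition free_basis :: "'x set \<Rightarrow> 'x \<Rightarrow> 'x \<Rightarrow> complex" where
  "free_basis S x = dsum_in S (\<lambda>_. complex_vs) x 1"

definition families :: "(complex, 'a) module \<Rightarrow> 'i set \<Rightarrow> ('i \<Rightarrow> 'a) set" where
  "families A I = (I \<rightarrow>\<^sub>E carrier A)"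

definition multilin_rel :: "(complex, 'a) module \<Rightarrow> 'i set \<Rightarrow> (('i \<Rightarrow> 'a) \<Rightarrow> complex) set" where
  "multilin_rel A I = (let F = free_vs (families A I); e = free_basis (families A I) in
     {e (a(i := x \<oplus>\<^bsub>A\<^esub> y)) \<ominus>\<^bsub>F\<^esub> (e (a(i := x)) \<oplus>\<^bsub>F\<^esub> e (a(i := y))) | a i x y.
        a \<in> families A I \<and> i \<in> I \<and> x \<in> carrier A \<and> y \<in> carrier A} \<union>
     {e (a(i := c \<odot>\<^bsub>A\<^esub> x)) \<ominus>\<^bsub>F\<^esub> (c \<odot>\<^bsub>F\<^esub> e (a(i := x))) | a i c x.
        a \<in> families A I \<and> i \<in> I \<and> x \<in> carrier A})"

type_synonym ('i, 'a) tensor = "(('i \<Rightarrow> 'a) \<Rightarrow> complex) set"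

definition tensor_kernel :: "(complex, 'a) module \<Rightarrow> 'i set \<Rightarrow> (('i \<Rightarrow> 'a) \<Rightarrow> complex) set" where
  "tensor_kernel A I = vspan (free_vs (families A I)) (multilin_rel A I)"

definition tpow :: "(complex, 'a) module \<Rightarrow> 'i set \<Rightarrow> (complex, ('i, 'a) tensor) module" where
  "tpow A I = quot_vs (free_vs (families A I)) (tensor_kernel A I)"

definition pure_tensor :: "(complex, 'a) module \<Rightarrow> 'i set \<Rightarrow> ('i \<Rightarrow> 'a) \<Rightarrow> ('i, 'a) tensor" where
  "pure_tensor A I a =
     tensor_kernel A I +>\<^bsub>free_vs (families A I)\<^esub> free_basis (families A I) a"

section \<open>Pointed finite sets and the functor \<open>\<L>(A)\<close> on \<open>\<Gamma>\<close>\<close>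

text \<open>A pointed set is a pair of its underlying set and its base point.\<close>

type_synonym 't pset = "'t set \<times> 't"

definition finite_pset :: "'t pset \<Rightarrow> bool" where
  "finite_pset T \<longleftrightarrow> finite (fst T) \<and> snd T \<in> fst T"

definition pmaps :: "'s pset \<Rightarrow> 't pset \<Rightarrow> ('s \<Rightarrow> 't) set" where
  "pmaps S T = {f \<in> fst S \<rightarrow>\<^sub>E fst T. f (snd S) = snd T}"

definition Gobj :: "nat \<Rightarrow> nat pset" where
  "Gobj n = ({0..n}, 0)"

definition LG :: "(complex, 'a) module \<Rightarrow> nat \<Rightarrow> (complex, (nat, 'a) tensor) module" where
  "LG A n = tpow A {0..n}"

definition LG_map :: "(complex, 'a) module \<Rightarrow> nat \<Rightarrow> nat \<Rightarrow> (nat \<Rightarrow> nat) \<Rightarrow>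
    (nat, 'a) tensor \<Rightarrow> (nat, 'a) tensor" where
  "LG_map A m n \<phi> = lin_ext (LG A m) (LG A n) (families A {0..m}) (pure_tensor A {0..m})
     (\<lambda>a. pure_tensor A {0..n} (\<lambda>j\<in>{0..n}. finprod A a {i \<in> {0..m}. \<phi> i = j}))"

definition LG_der :: "(complex, 'a) module \<Rightarrow> ('a \<Rightarrow> 'a) \<Rightarrow> nat \<Rightarrow>
    (nat, 'a) tensor \<Rightarrow> (nat, 'a) tensor" where
  "LG_der A D n = lin_ext (LG A n) (LG A n) (families A {0..n}) (pure_tensor A {0..n})
     (\<lambda>a. \<Oplus>\<^bsub>LG A n\<^esub>i\<in>{0..n}. pure_tensor A {0..n} (a(i := D (a i))))"

section \<open>Extension to finite pointed sets\<close>

text \<open>The colimit over the category of pairs \<open>(m, \<phi>)\<close> with \<open>\<phi> : [m] \<rightarrow> T\<close> pointed, whose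
  morphisms \<open>(m, \<phi>' \<circ> \<psi>) \<rightarrow> (m', \<phi>')\<close> are the pointed maps \<open>\<psi> : [m] \<rightarrow> [m']\<close>: the direct sum of the
  values modulo the identifications along the morphisms. \<open>colim_in\<close> is the colimit cocone.\<close>

definition slice :: "'t pset \<Rightarrow> (nat \<times> (nat \<Rightarrow> 't)) set" where
  "slice T = {(m, \<phi>). \<phi> \<in> pmaps (Gobj m) T}"

type_synonym ('t, 'a) lsum = "nat \<times> (nat \<Rightarrow> 't) \<Rightarrow> (nat, 'a) tensor"
type_synonym ('t, 'a) lobj = "('t, 'a) lsum set"

definition colim_sum ::
  "(complex, 'a) module \<Rightarrow> 't pset \<Rightarrow> (complex, ('t, 'a) lsum) module" where
  "colim_sum A T = dsum_vs (slice T) (\<lambda>(m, \<phi>). LG A m)"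

definition colim_sum_in :: "(complex, 'a) module \<Rightarrow> 't pset \<Rightarrow> nat \<times> (nat \<Rightarrow> 't) \<Rightarrow>
    (nat, 'a) tensor \<Rightarrow> ('t, 'a) lsum" where
  "colim_sum_in A T = dsum_in (slice T) (\<lambda>(m, \<phi>). LG A m)"

definition colim_kernel :: "(complex, 'a) module \<Rightarrow> 't pset \<Rightarrow> ('t, 'a) lsum set" where
  "colim_kernel A T = vspan (colim_sum A T)
     {colim_sum_in A T (m, compose {0..m} \<phi>' \<psi>) x \<ominus>\<^bsub>colim_sum A T\<^esub>
        colim_sum_in A T (m', \<phi>') (LG_map A m m' \<psi> x) | m m' \<phi>' \<psi> x.
      (m', \<phi>') \<in> slice T \<and> \<psi> \<in> pmaps (Gobj m) (Gobj m') \<and> x \<in> carrier (LG A m)}"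

definition LF :: "(complex, 'a) module \<Rightarrow> 't pset \<Rightarrow> (complex, ('t, 'a) lobj) module" where
  "LF A T = quot_vs (colim_sum A T) (colim_kernel A T)"

definition colim_in :: "(complex, 'a) module \<Rightarrow> 't pset \<Rightarrow> nat \<times> (nat \<Rightarrow> 't) \<Rightarrow>
    (nat, 'a) tensor \<Rightarrow> ('t, 'a) lobj" where
  "colim_in A T p x = colim_kernel A T +>\<^bsub>colim_sum A T\<^esub> colim_sum_in A T p x"

text \<open>Linear maps out of the colimit, given on the images \<open>colim_in A T (m, \<phi>) x\<close> of the cocone.\<close>

definition LF_map :: "(complex, 'a) module \<Rightarrow> 't pset \<Rightarrow> 't pset \<Rightarrow> ('t \<Rightarrow> 't) \<Rightarrow>
    ('t, 'a) lobj \<Rightarrow> ('t, 'a) lobj" where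
  "LF_map A T T' f = lin_ext (LF A T) (LF A T') (SIGMA p : slice T. carrier (LG A (fst p)))
     (\<lambda>(p, x). colim_in A T p x)
     (\<lambda>((m, \<phi>), x). colim_in A T' (m, compose {0..m} f \<phi>) x)"

definition LF_der :: "(complex, 'a) module \<Rightarrow> ('a \<Rightarrow> 'a) \<Rightarrow> 't pset \<Rightarrow>
    ('t, 'a) lobj \<Rightarrow> ('t, 'a) lobj" where
  "LF_der A D T = lin_ext (LF A T) (LF A T) (SIGMA p : slice T. carrier (LG A (fst p)))
     (\<lambda>(p, x). colim_in A T p x)
     (\<lambda>((m, \<phi>), x). colim_in A T (m, \<phi>) (LG_der A D m x))"

section \<open>Pointed simplicial finite sets\<close>

definition simplex_maps :: "nat \<Rightarrow> nat \<Rightarrow> (nat \<Rightarrow> nat) set" where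
  "simplex_maps m n = {\<theta> \<in> {0..m} \<rightarrow>\<^sub>E {0..n}. mono_on {0..m} \<theta>}"

text \<open>\<open>act Y m n \<theta> : ob Y n \<rightarrow> ob Y m\<close> is the map induced by \<open>\<theta> : [m] \<rightarrow> [n]\<close>.\<close>

record 't simplicial_pset =
  ob :: "nat \<Rightarrow> 't pset"
  act :: "nat \<Rightarrow> nat \<Rightarrow> (nat \<Rightarrow> nat) \<Rightarrow> 't \<Rightarrow> 't"

definition pointed_simplicial_finite_set :: "'t simplicial_pset \<Rightarrow> bool" where
  "pointed_simplicial_finite_set Y \<longleftrightarrow>
     (\<forall>n. finite_pset (ob Y n)) \<and>
     (\<forall>m n. \<forall>\<theta>\<in>simplex_maps m n. act Y m n \<theta> \<in> pmaps (ob Y n) (ob Y m)) \<and>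
     (\<forall>n. act Y n n (\<lambda>i\<in>{0..n}. i) = (\<lambda>t\<in>fst (ob Y n). t)) \<and>
     (\<forall>l m n. \<forall>\<theta>\<in>simplex_maps l m. \<forall>\<eta>\<in>simplex_maps m n.
        act Y l n (compose {0..l} \<eta> \<theta>) = compose (fst (ob Y n)) (act Y l m \<theta>) (act Y m n \<eta>))"

text \<open>The coface \<open>[n - 1] \<rightarrow> [n]\<close> omitting \<open>i\<close>, used for \<open>n \<ge> 1\<close>.\<close>

definition coface :: "nat \<Rightarrow> nat \<Rightarrow> nat \<Rightarrow> nat" where
  "coface n i = (\<lambda>j\<in>{0..n - 1}. if j < i then j else Suc j)"

section \<open>The \<open>N\<close>-complex \<open>(\<L>\<^sup>Y(A), b)\<close>\<close>

definition LY ::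
  "(complex, 'a) module \<Rightarrow> 't simplicial_pset \<Rightarrow> int \<Rightarrow> (complex, ('t, 'a) lobj) module" where
  "LY A Y n = (if n < 0 then zero_vs else LF A (ob Y (nat n)))"

definition LY_face :: "(complex, 'a) module \<Rightarrow> 't simplicial_pset \<Rightarrow> nat \<Rightarrow> nat \<Rightarrow>
    ('t, 'a) lobj \<Rightarrow> ('t, 'a) lobj" where
  "LY_face A Y n i = LF_map A (ob Y n) (ob Y (n - 1)) (act Y (n - 1) n (coface n i))"

definition LY_b :: "(complex, 'a) module \<Rightarrow> 't simplicial_pset \<Rightarrow> complex \<Rightarrow> int \<Rightarrow>
    ('t, 'a) lobj \<Rightarrow> ('t, 'a) lobj" where
  "LY_b A Y q n = (\<lambda>x\<in>carrier (LY A Y n).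
     if n \<le> 0 then \<zero>\<^bsub>LY A Y (n - 1)\<^esub>
     else \<Oplus>\<^bsub>LY A Y (n - 1)\<^esub>i\<in>{0..nat n}. (q ^ i) \<odot>\<^bsub>LY A Y (n - 1)\<^esub> LY_face A Y (nat n) i x)"

definition LY_der :: "(complex, 'a) module \<Rightarrow> ('a \<Rightarrow> 'a) \<Rightarrow> 't simplicial_pset \<Rightarrow> int \<Rightarrow>
    ('t, 'a) lobj \<Rightarrow> ('t, 'a) lobj" where
  "LY_der A D Y n =
     (if n < 0 then (\<lambda>x\<in>carrier (LY A Y n). \<zero>\<^bsub>LY A Y n\<^esub>) else LF_der A D (ob Y (nat n)))"

section \<open>Homology of \<open>N\<close>-complexes\<close>

text \<open>\<open>iter_d d i n = d\<^sup>i : C\<^sub>n \<rightarrow> C\<^sub>n\<^sub>-\<^sub>i\<close> for a family \<open>d n : C\<^sub>n \<rightarrow> C\<^sub>n\<^sub>-\<^sub>1\<close>.\<close>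

primrec iter_d :: "(int \<Rightarrow> 'v \<Rightarrow> 'v) \<Rightarrow> nat \<Rightarrow> int \<Rightarrow> 'v \<Rightarrow> 'v" where
  "iter_d d 0 n x = x"
| "iter_d d (Suc i) n x = d (n - int i) (iter_d d i n x)"

definition cycles ::
  "(int \<Rightarrow> (complex, 'v) module) \<Rightarrow> (int \<Rightarrow> 'v \<Rightarrow> 'v) \<Rightarrow> nat \<Rightarrow> int \<Rightarrow> 'v set" where
  "cycles C d i n = {x \<in> carrier (C n). iter_d d i n x = \<zero>\<^bsub>C (n - int i)\<^esub>}"

definition boundaries ::
  "nat \<Rightarrow> (int \<Rightarrow> (complex, 'v) module) \<Rightarrow> (int \<Rightarrow> 'v \<Rightarrow> 'v) \<Rightarrow> nat \<Rightarrow> int \<Rightarrow> 'v set" where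
  "boundaries N C d i n =
     iter_d d (N - i) (n + int (N - i)) ` carrier (C (n + int (N - i)))"

definition homology_part :: "nat \<Rightarrow> (int \<Rightarrow> (complex, 'v) module) \<Rightarrow> (int \<Rightarrow> 'v \<Rightarrow> 'v) \<Rightarrow>
    nat \<Rightarrow> int \<Rightarrow> (complex, 'v set) module" where
  "homology_part N C d i n = quot_vs ((C n)\<lparr>carrier := cycles C d i n\<rparr>) (boundaries N C d i n)"

definition homology_class :: "nat \<Rightarrow> (int \<Rightarrow> (complex, 'v) module) \<Rightarrow> (int \<Rightarrow> 'v \<Rightarrow> 'v) \<Rightarrow>
    nat \<Rightarrow> int \<Rightarrow> 'v \<Rightarrow> 'v set" where
  "homology_class N C d i n x = boundaries N C d i n +>\<^bsub>C n\<^esub> x"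

definition homology :: "nat \<Rightarrow> (int \<Rightarrow> (complex, 'v) module) \<Rightarrow> (int \<Rightarrow> 'v \<Rightarrow> 'v) \<Rightarrow>
    int \<Rightarrow> (complex, nat \<Rightarrow> 'v set) module" where
  "homology N C d n = dsum_vs {1..<N} (\<lambda>i. homology_part N C d i n)"

section \<open>Bivariant \<open>q\<close>-Hochschild cohomology\<close>

type_synonym ('t, 'a) lhom = "int \<Rightarrow> ('t, 'a) lobj \<Rightarrow> ('t, 'a) lobj"

definition HomY ::
  "(complex, 'a) module \<Rightarrow> 't simplicial_pset \<Rightarrow> int \<Rightarrow> (complex, ('t, 'a) lhom) module" where
  "HomY A Y n = prod_vs UNIV (\<lambda>i. hom_vs (LY A Y i) (LY A Y (i + n)))"

definition HomY_d :: "(complex, 'a) module \<Rightarrow> 't simplicial_pset \<Rightarrow> complex \<Rightarrow> int \<Rightarrow>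
    ('t, 'a) lhom \<Rightarrow> ('t, 'a) lhom" where
  "HomY_d A Y q n f = (\<lambda>i. \<lambda>x\<in>carrier (LY A Y i).
     LY_b A Y q (i + n) (f i x) \<ominus>\<^bsub>LY A Y (i + n - 1)\<^esub>
       (q powi n) \<odot>\<^bsub>LY A Y (i + n - 1)\<^esub> f (i - 1) (LY_b A Y q i x))"

definition HomY_der :: "(complex, 'a) module \<Rightarrow> ('a \<Rightarrow> 'a) \<Rightarrow> 't simplicial_pset \<Rightarrow> int \<Rightarrow>
    ('t, 'a) lhom \<Rightarrow> ('t, 'a) lhom" where
  "HomY_der A D Y n f = (\<lambda>i. \<lambda>x\<in>carrier (LY A Y i).
     LY_der A D Y (i + n) (f i x) \<ominus>\<^bsub>LY A Y (i + n)\<^esub> f i (LY_der A D Y i x))"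

definition HHY :: "(complex, 'a) module \<Rightarrow> 't simplicial_pset \<Rightarrow> nat \<Rightarrow> complex \<Rightarrow> int \<Rightarrow>
    (complex, nat \<Rightarrow> ('t, 'a) lhom set) module" where
  "HHY A Y N q n = homology N (HomY A Y) (HomY_d A Y q) (- n)"

definition primitive_root_of_unity :: "nat \<Rightarrow> complex \<Rightarrow> bool" where
  "primitive_root_of_unity N q \<longleftrightarrow> 0 < N \<and> q ^ N = 1 \<and> (\<forall>k. 0 < k \<and> k < N \<longrightarrow> q ^ k \<noteq> 1)"

end

theory Submission
  imports Defs
begin

text \<open>
  The reason for the theorem is that \<open>L\<^sub>D\<close> is natural. For a pointed map \<open>\<phi> : [m] \<rightarrow> [n]\<close>, the map
  \<open>\<L>(A)(\<phi>)\<close> multiplies the entries of a pure tensor over the fibres of \<open>\<phi>\<close>, and the Leibniz rule for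
  finite products turns \<open>D\<close> of such a product into the sum over the fibre of the products with \<open>D\<close>
  applied to one entry. Summing over all fibres gives \<open>L\<^sub>D \<circ> \<L>(A)(\<phi>) = \<L>(A)(\<phi>) \<circ> L\<^sub>D\<close>
  (\<open>LG_der_natural\<close>).

  It follows that \<open>L\<^sub>D\<close> is compatible with the identifications that define the colimit \<open>\<L>(A)(T)\<close>,
  hence well defined there, and natural in \<open>T\<close> (\<open>LF_der_natural\<close>). In particular it commutes with
  the faces of \<open>\<L>\<^sup>Y(A)\<close>, and so with the differential \<open>b\<close>, a linear combination of faces
  (\<open>LY_b_der\<close>). The commutator \<open>f \<mapsto> L f - f L\<close> then commutes with the differential
  \<open>f \<mapsto> b f - q\<^sup>n f b\<close> of the Hom complex (\<open>HomY_der_d\<close>). Such an endomorphism preserves the kernels and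
  the images of all iterates of the differential, so it induces one and only one linear map on the
  homology with the prescribed values on classes (\<open>induced_map_on_homology\<close>).

  Most of the work below is to show that the maps involved exist: tensor powers and colimits are
  concrete quotients, and maps out of them are definite descriptions, which are given meaning by
  the universal properties of direct sums, quotients (\<open>vspan_quot_lift\<close>), tensor powers
  (\<open>tpow_lift\<close>) and the colimit (\<open>LF_lin_ext\<close>).
\<close>

section \<open>Linear algebra over the complex numbers\<close>

text \<open>\<open>cvs V\<close> says that \<open>V\<close> is a complex vector space.\<close>

abbreviation cvs :: "(complex, 'v) module \<Rightarrow> bool" where
  "cvs V \<equiv> module complex_field V"

lemma complex_field_simps [simp]:
  "carrier complex_field = UNIV" "\<zero>\<^bsub>complex_field\<^esub> = 0" "\<one>\<^bsub>complex_field\<^esub> = 1"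
  "x \<oplus>\<^bsub>complex_field\<^esub> y = x + y" "x \<otimes>\<^bsub>complex_field\<^esub> y = x * y"
  by (simp_all add: ring_of_type_algebra_def)

lemma mk_vs_simps [simp]:
  "carrier (mk_vs C z a s) = C" "\<zero>\<^bsub>mk_vs C z a s\<^esub> = z"
  "x \<oplus>\<^bsub>mk_vs C z a s\<^esub> y = a x y" "c \<odot>\<^bsub>mk_vs C z a s\<^esub> x = s c x"
  by (simp_all add: mk_vs_def)

text \<open>The law \<open>0 x = 0\<close> replaces the existence of additive inverses: \<open>(-1) x\<close> is then one.\<close>

lemma cvsI:
  fixes V (structure)
  assumes zero: "\<zero> \<in> carrier V"
    and add: "\<And>x y. x \<in> carrier V \<Longrightarrow> y \<in> carrier V \<Longrightarrow> x \<oplus> y \<in> carrier V"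
    and smult: "\<And>c x. x \<in> carrier V \<Longrightarrow> c \<odot> x \<in> carrier V"
    and assoc: "\<And>x y z. x \<in> carrier V \<Longrightarrow> y \<in> carrier V \<Longrightarrow> z \<in> carrier V \<Longrightarrow>
      (x \<oplus> y) \<oplus> z = x \<oplus> (y \<oplus> z)"
    and comm: "\<And>x y. x \<in> carrier V \<Longrightarrow> y \<in> carrier V \<Longrightarrow> x \<oplus> y = y \<oplus> x"
    and zero_add: "\<And>x. x \<in> carrier V \<Longrightarrow> \<zero> \<oplus> x = x"
    and l_distr: "\<And>c d x. x \<in> carrier V \<Longrightarrow> (c + d) \<odot> x = c \<odot> x \<oplus> d \<odot> x"
    and r_distr: "\<And>c x y. x \<in> carrier V \<Longrightarrow> y \<in> carrier V \<Longrightarrow> c \<odot> (x \<oplus> y) = c \<odot> x \<oplus> c \<odot> y"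
    and assoc1: "\<And>c d x. x \<in> carrier V \<Longrightarrow> (c * d) \<odot> x = c \<odot> (d \<odot> x)"
    and one: "\<And>x. x \<in> carrier V \<Longrightarrow> 1 \<odot> x = x"
    and null: "\<And>x. x \<in> carrier V \<Longrightarrow> 0 \<odot> x = \<zero>"
  shows "cvs V"
proof (rule moduleI)
  show "cring complex_field" by (rule cring_from_type_algebra)
  show "abelian_group V"
  proof (rule abelian_groupI)
    fix x assume x: "x \<in> carrier V"
    have "(-1) \<odot> x \<oplus> x = (-1 + 1) \<odot> x"
      using x one l_distr by metis
    then show "\<exists>y\<in>carrier V. y \<oplus> x = \<zero>"
      using x null smult by (intro bexI[of _ "(-1) \<odot> x"]) auto
  qed (use assms in auto)
qed (use assms in auto)

lemma smult_minus_one: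
  assumes "cvs V" "x \<in> carrier V"
  shows "(-1) \<odot>\<^bsub>V\<^esub> x = \<ominus>\<^bsub>V\<^esub> x"
proof -
  interpret V: module complex_field V by fact
  have "(-1) \<odot>\<^bsub>V\<^esub> x \<oplus>\<^bsub>V\<^esub> x = (-1 + 1) \<odot>\<^bsub>V\<^esub> x"
    using V.smult_l_distr[of "-1" 1 x] assms V.smult_one[of x] by simp
  then have "(-1) \<odot>\<^bsub>V\<^esub> x \<oplus>\<^bsub>V\<^esub> x = \<zero>\<^bsub>V\<^esub>"
    using V.smult_l_null[of x] assms by simp
  then show ?thesis using V.minus_equality assms by simp
qed

lemma minus_conv_smult:
  assumes "cvs V" "y \<in> carrier V"
  shows "x \<ominus>\<^bsub>V\<^esub> y = x \<oplus>\<^bsub>V\<^esub> (-1) \<odot>\<^bsub>V\<^esub> y"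
  using smult_minus_one[OF assms] by (simp add: a_minus_def)

lemma minus_add_minus:
  assumes "cvs V" "a \<in> carrier V" "b \<in> carrier V" "c \<in> carrier V" "e \<in> carrier V"
  shows "(a \<oplus>\<^bsub>V\<^esub> b) \<ominus>\<^bsub>V\<^esub> (c \<oplus>\<^bsub>V\<^esub> e) = (a \<ominus>\<^bsub>V\<^esub> c) \<oplus>\<^bsub>V\<^esub> (b \<ominus>\<^bsub>V\<^esub> e)"
proof -
  interpret V: module complex_field V by fact
  show ?thesis using assms by (simp add: a_minus_def V.minus_add V.a_ac)
qed

lemma minus_minus_minus:
  assumes "cvs V" "a \<in> carrier V" "b \<in> carrier V" "c \<in> carrier V" "e \<in> carrier V"
  shows "(a \<ominus>\<^bsub>V\<^esub> b) \<ominus>\<^bsub>V\<^esub> (c \<ominus>\<^bsub>V\<^esub> e) = (a \<ominus>\<^bsub>V\<^esub> c) \<ominus>\<^bsub>V\<^esub> (b \<ominus>\<^bsub>V\<^esub> e)"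
proof -
  interpret V: module complex_field V by fact
  show ?thesis using assms by (simp add: a_minus_def V.minus_add V.a_ac)
qed

lemma smult_minus:
  assumes "cvs V" "a \<in> carrier V" "b \<in> carrier V"
  shows "c \<odot>\<^bsub>V\<^esub> (a \<ominus>\<^bsub>V\<^esub> b) = c \<odot>\<^bsub>V\<^esub> a \<ominus>\<^bsub>V\<^esub> c \<odot>\<^bsub>V\<^esub> b"
proof -
  interpret V: module complex_field V by fact
  show ?thesis using assms by (simp add: a_minus_def V.smult_r_distr V.smult_r_minus)
qed

lemma smult_commute:
  assumes "cvs V" "a \<in> carrier V"
  shows "c \<odot>\<^bsub>V\<^esub> (e \<odot>\<^bsub>V\<^esub> a) = e \<odot>\<^bsub>V\<^esub> (c \<odot>\<^bsub>V\<^esub> a)"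
proof -
  interpret V: module complex_field V by fact
  show ?thesis
    using assms V.smult_assoc1[of c e a] V.smult_assoc1[of e c a] by (simp add: mult.commute)
qed

lemma cvs_submoduleI:
  fixes V (structure)
  assumes "cvs V" "H \<subseteq> carrier V" "\<zero> \<in> H"
    and "\<And>x y. x \<in> H \<Longrightarrow> y \<in> H \<Longrightarrow> x \<oplus> y \<in> H"
    and "\<And>c x. x \<in> H \<Longrightarrow> c \<odot> x \<in> H"
  shows "submodule H complex_field V"
proof -
  interpret V: module complex_field V by fact
  show ?thesis
    by (rule V.submoduleI)
      (use assms smult_minus_one[OF assms(1)] in \<open>auto simp flip: smult_minus_one\<close>)
qed

lemma submodule_zero:
  assumes "submodule H complex_field V"
  shows "\<zero>\<^bsub>V\<^esub> \<in> H"
  using subgroup.one_closed[OF submodule.axioms(1)[OF assms]] by simp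

subsection \<open>Linear maps\<close>

lemma lin_mapI:
  assumes "\<And>x. x \<in> carrier V \<Longrightarrow> h x \<in> carrier W"
    and "\<And>x y. x \<in> carrier V \<Longrightarrow> y \<in> carrier V \<Longrightarrow> h (x \<oplus>\<^bsub>V\<^esub> y) = h x \<oplus>\<^bsub>W\<^esub> h y"
    and "\<And>c x. x \<in> carrier V \<Longrightarrow> h (c \<odot>\<^bsub>V\<^esub> x) = c \<odot>\<^bsub>W\<^esub> h x"
  shows "lin_map V W h"
  using assms by (auto simp: lin_map_def)

lemma lin_mapD:
  assumes "lin_map V W h"
  shows lin_map_closed: "x \<in> carrier V \<Longrightarrow> h x \<in> carrier W"
    and lin_map_add: "x \<in> carrier V \<Longrightarrow> y \<in> carrier V \<Longrightarrow> h (x \<oplus>\<^bsub>V\<^esub> y) = h x \<oplus>\<^bsub>W\<^esub> h y"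
    and lin_map_smult: "x \<in> carrier V \<Longrightarrow> h (c \<odot>\<^bsub>V\<^esub> x) = c \<odot>\<^bsub>W\<^esub> h x"
  using assms by (auto simp: lin_map_def)

lemma lin_map_zero:
  assumes "cvs V" "cvs W" "lin_map V W h"
  shows "h \<zero>\<^bsub>V\<^esub> = \<zero>\<^bsub>W\<^esub>"
proof -
  interpret V: module complex_field V by fact
  interpret W: module complex_field W by fact
  have "h (0 \<odot>\<^bsub>V\<^esub> \<zero>\<^bsub>V\<^esub>) = 0 \<odot>\<^bsub>W\<^esub> h \<zero>\<^bsub>V\<^esub>"
    by (rule lin_map_smult[OF assms(3)]) simp
  then show ?thesis
    using V.smult_l_null[of "\<zero>\<^bsub>V\<^esub>"] W.smult_l_null[of "h \<zero>\<^bsub>V\<^esub>"] lin_map_closed[OF assms(3)] by simp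
qed

lemma lin_map_minus:
  assumes "cvs V" "cvs W" "lin_map V W h" "x \<in> carrier V" "y \<in> carrier V"
  shows "h (x \<ominus>\<^bsub>V\<^esub> y) = h x \<ominus>\<^bsub>W\<^esub> h y"
proof -
  interpret V: module complex_field V by fact
  show ?thesis
    using assms(4,5) lin_mapD[OF assms(3)]
    by (simp add: minus_conv_smult[OF assms(1)] minus_conv_smult[OF assms(2)])
qed

lemma lin_map_finsum:
  assumes "cvs V" "cvs W" "lin_map V W h" "f \<in> I \<rightarrow> carrier V"
  shows "h (\<Oplus>\<^bsub>V\<^esub>i\<in>I. f i) = (\<Oplus>\<^bsub>W\<^esub>i\<in>I. h (f i))"
proof -
  interpret V: module complex_field V by fact
  interpret W: module complex_field W by fact
  show ?thesis using assms(4)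
  proof (induction I rule: infinite_finite_induct)
    case (insert i I)
    then have "h (\<Oplus>\<^bsub>V\<^esub>i\<in>insert i I. f i) = h (f i) \<oplus>\<^bsub>W\<^esub> h (\<Oplus>\<^bsub>V\<^esub>i\<in>I. f i)"
      by (subst V.finsum_insert) (auto simp: lin_map_add[OF assms(3)] Pi_iff intro!: V.finsum_closed)
    also have "\<dots> = (\<Oplus>\<^bsub>W\<^esub>i\<in>insert i I. h (f i))"
      using insert by (subst W.finsum_insert) (auto simp: Pi_iff lin_map_closed[OF assms(3)])
    finally show ?case .
  qed (auto simp: lin_map_zero[OF assms(1-3)])
qed

lemma lin_map_compose:
  assumes "lin_map U V h" "lin_map V W k"
  shows "lin_map U W (\<lambda>x. k (h x))"
  using assms by (auto simp: lin_map_def Pi_iff)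

lemma lin_map_cong:
  assumes "cvs V" "\<And>x. x \<in> carrier V \<Longrightarrow> h x = k x"
  shows "lin_map V W h \<longleftrightarrow> lin_map V W k"
proof -
  interpret V: module complex_field V by fact
  show ?thesis unfolding lin_map_def by (simp add: assms(2) Pi_iff)
qed

lemma vhomD:
  assumes "h \<in> vhom V W"
  shows "h \<in> extensional (carrier V)" "lin_map V W h"
  using assms by (auto simp: vhom_def)

lemma restrict_vhom:
  assumes "cvs V" "lin_map V W h"
  shows "restrict h (carrier V) \<in> vhom V W"
  using assms lin_map_cong[OF assms(1), of "restrict h (carrier V)" h W] by (simp add: vhom_def)

lemma vhom_eqI:
  assumes "h \<in> vhom V W" "k \<in> vhom V W'" "\<And>x. x \<in> carrier V \<Longrightarrow> h x = k x"
  shows "h = k"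
  using assms extensionalityI[of h "carrier V" k] by (auto simp: vhom_def)

lemma lin_map_id: "lin_map V V (\<lambda>x. x)"
  by (simp add: lin_map_def)

lemma lin_map_zero_map:
  assumes "cvs W"
  shows "lin_map V W (\<lambda>x. \<zero>\<^bsub>W\<^esub>)"
proof -
  interpret W: module complex_field W by fact
  show ?thesis by (rule lin_mapI) auto
qed

lemma lin_map_add_map:
  assumes "cvs W" "lin_map V W h" "lin_map V W k"
  shows "lin_map V W (\<lambda>x. h x \<oplus>\<^bsub>W\<^esub> k x)"
proof -
  interpret W: module complex_field W by fact
  show ?thesis
    by (rule lin_mapI)
      (simp_all add: lin_mapD[OF assms(2)] lin_mapD[OF assms(3)] W.smult_r_distr W.add.m_ac)
qed

lemma lin_map_smult_map:
  assumes "cvs W" "lin_map V W h"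
  shows "lin_map V W (\<lambda>x. c \<odot>\<^bsub>W\<^esub> h x)"
proof -
  interpret W: module complex_field W by fact
  show ?thesis
    using smult_commute[OF assms(1)]
    by (intro lin_mapI) (simp_all add: lin_mapD[OF assms(2)] W.smult_r_distr)
qed

lemma lin_map_minus_map:
  assumes "cvs V" "cvs W" "lin_map V W h" "lin_map V W k"
  shows "lin_map V W (\<lambda>x. h x \<ominus>\<^bsub>W\<^esub> k x)"
proof -
  have "lin_map V W (\<lambda>x. h x \<oplus>\<^bsub>W\<^esub> (-1) \<odot>\<^bsub>W\<^esub> k x)"
    by (intro lin_map_add_map lin_map_smult_map assms)
  then show ?thesis
    by (subst lin_map_cong[OF assms(1)])
      (simp_all add: minus_conv_smult[OF assms(2)] lin_map_closed[OF assms(4)])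
qed

lemma lin_map_finsum_map:
  assumes "cvs V" "cvs W" "\<And>i. i \<in> I \<Longrightarrow> lin_map V W (h i)"
  shows "lin_map V W (\<lambda>x. \<Oplus>\<^bsub>W\<^esub>i\<in>I. h i x)"
proof -
  interpret V: module complex_field V by fact
  interpret W: module complex_field W by fact
  have cl: "h i x \<in> carrier W" if "i \<in> I" "x \<in> carrier V" for i x
    using lin_map_closed[OF assms(3)] that by auto
  show ?thesis
  proof (cases "finite I")
    case fin: True
    show ?thesis
    proof (rule lin_mapI)
      fix x y assume xy: "x \<in> carrier V" "y \<in> carrier V"
      have "(\<Oplus>\<^bsub>W\<^esub>i\<in>I. h i (x \<oplus>\<^bsub>V\<^esub> y)) = (\<Oplus>\<^bsub>W\<^esub>i\<in>I. h i x \<oplus>\<^bsub>W\<^esub> h i y)"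
        by (rule W.finsum_cong') (use xy in \<open>auto simp: cl lin_map_add[OF assms(3)]\<close>)
      also have "\<dots> = (\<Oplus>\<^bsub>W\<^esub>i\<in>I. h i x) \<oplus>\<^bsub>W\<^esub> (\<Oplus>\<^bsub>W\<^esub>i\<in>I. h i y)"
        by (rule W.finsum_addf) (use xy cl in auto)
      finally show "(\<Oplus>\<^bsub>W\<^esub>i\<in>I. h i (x \<oplus>\<^bsub>V\<^esub> y)) = (\<Oplus>\<^bsub>W\<^esub>i\<in>I. h i x) \<oplus>\<^bsub>W\<^esub> (\<Oplus>\<^bsub>W\<^esub>i\<in>I. h i y)" .
    next
      fix c x assume "x \<in> carrier V"
      then show "(\<Oplus>\<^bsub>W\<^esub>i\<in>I. h i (c \<odot>\<^bsub>V\<^esub> x)) = c \<odot>\<^bsub>W\<^esub> (\<Oplus>\<^bsub>W\<^esub>i\<in>I. h i x)"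
        by (subst W.finsum_smult_ldistr)
          (auto simp: fin cl lin_map_smult[OF assms(3)] intro!: W.finsum_cong')
    qed (auto simp: cl intro!: W.finsum_closed)
  next
    case False
    then show ?thesis
      using lin_map_zero_map[OF assms(2)] by (simp add: W.finsum_infinite)
  qed
qed

subsection \<open>Spans\<close>

lemma submodule_equalizer:
  assumes "cvs V" "cvs W" "lin_map V W h" "lin_map V W k"
  shows "submodule {x \<in> carrier V. h x = k x} complex_field V"
proof -
  interpret V: module complex_field V by fact
  show ?thesis
    by (rule cvs_submoduleI[OF assms(1)])
      (auto simp: lin_mapD[OF assms(3)] lin_mapD[OF assms(4)]
        lin_map_zero[OF assms(1-3)] lin_map_zero[OF assms(1,2,4)])
qed

lemma submodule_vimage:
  assumes "cvs V" "cvs W" "lin_map V W h" "submodule H complex_field W"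
  shows "submodule {x \<in> carrier V. h x \<in> H} complex_field V"
proof -
  interpret V: module complex_field V by fact
  interpret W: module complex_field W by fact
  show ?thesis
    by (rule cvs_submoduleI[OF assms(1)])
      (auto simp: lin_mapD[OF assms(3)] lin_map_zero[OF assms(1-3)] submodule_zero[OF assms(4)]
        W.submoduleE[OF assms(4)])
qed

lemma submodule_image:
  assumes "cvs V" "cvs W" "lin_map V W h" "submodule H complex_field V"
  shows "submodule (h ` H) complex_field W"
proof -
  interpret V: module complex_field V by fact
  interpret W: module complex_field W by fact
  have sub: "x \<in> carrier V" if "x \<in> H" for x
    using V.submoduleE(1)[OF assms(4)] that by auto
  show ?thesis
  proof (rule cvs_submoduleI[OF assms(2)])
    show "h ` H \<subseteq> carrier W" using sub lin_map_closed[OF assms(3)] by auto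
    show "\<zero>\<^bsub>W\<^esub> \<in> h ` H"
      using lin_map_zero[OF assms(1-3)] submodule_zero[OF assms(4)] by (metis imageI)
    show "x \<oplus>\<^bsub>W\<^esub> y \<in> h ` H" if "x \<in> h ` H" "y \<in> h ` H" for x y
      using that V.submoduleE(5)[OF assms(4)] sub
      by (auto simp flip: lin_map_add[OF assms(3)])
    show "c \<odot>\<^bsub>W\<^esub> x \<in> h ` H" if "x \<in> h ` H" for c x
      using that V.submoduleE(4)[OF assms(4)] sub
      by (auto simp flip: lin_map_smult[OF assms(3)])
  qed
qed

lemma vspan_superset: "B \<subseteq> vspan V B"
  by (auto simp: vspan_def)

lemma vspan_minimal: "submodule H complex_field V \<Longrightarrow> B \<subseteq> H \<Longrightarrow> vspan V B \<subseteq> H"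
  by (auto simp: vspan_def)

lemma submodule_vspan:
  assumes "cvs V" "B \<subseteq> carrier V"
  shows "submodule (vspan V B) complex_field V"
proof -
  interpret V: module complex_field V by fact
  show ?thesis
  proof (rule cvs_submoduleI[OF assms(1)])
    show "vspan V B \<subseteq> carrier V"
      by (rule vspan_minimal[OF V.carrier_is_submodule assms(2)])
  qed (auto simp: vspan_def submodule_zero intro: V.submoduleE(5) V.submoduleE(4))
qed

lemma spanning_eq:
  assumes "cvs V" "cvs W" "lin_map V W h" "lin_map V W k" "carrier V \<subseteq> vspan V B"
    and "B \<subseteq> carrier V" "\<And>x. x \<in> B \<Longrightarrow> h x = k x" "x \<in> carrier V"
  shows "h x = k x"
proof -
  have "vspan V B \<subseteq> {x \<in> carrier V. h x = k x}"
    by (rule vspan_minimal[OF submodule_equalizer[OF assms(1-4)]]) (use assms in auto)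
  then show ?thesis using assms by auto
qed

lemma spanning_image:
  assumes "cvs V" "cvs W" "lin_map V W h" "carrier W \<subseteq> h ` carrier V"
    and "carrier V \<subseteq> vspan V B"  "B \<subseteq> carrier V"
  shows "carrier W \<subseteq> vspan W (h ` B)"
proof -
  have "submodule (vspan W (h ` B)) complex_field W"
    by (rule submodule_vspan[OF assms(2)]) (use assms lin_map_closed[OF assms(3)] in auto)
  from submodule_vimage[OF assms(1-3) this]
  have "vspan V B \<subseteq> {x \<in> carrier V. h x \<in> vspan W (h ` B)}"
    by (rule vspan_minimal) (use assms(6) vspan_superset in force)
  then show ?thesis using assms(4,5) by auto
qed

text \<open>The definite description in \<open>lin_ext\<close> is meaningful as soon as the generators span and the
  prescribed values extend to some linear map; this is how each map defined through \<open>lin_ext\<close>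
  is shown to have its intended values.\<close>

lemma lin_ext_spec:
  assumes "cvs V" "cvs W" "carrier V \<subseteq> vspan V (gen ` S)" "gen ` S \<subseteq> carrier V"
    and "lin_map V W h" "\<And>x. x \<in> S \<Longrightarrow> h (gen x) = val x"
  shows "lin_ext V W S gen val \<in> vhom V W"
    and "x \<in> S \<Longrightarrow> lin_ext V W S gen val (gen x) = val x"
proof -
  have "\<exists>!g. g \<in> vhom V W \<and> (\<forall>x\<in>S. g (gen x) = val x)"
  proof (rule ex1I)
    show "restrict h (carrier V) \<in> vhom V W \<and> (\<forall>x\<in>S. restrict h (carrier V) (gen x) = val x)"
      using restrict_vhom[OF assms(1,5)] assms(4,6) by auto
  next
    fix g assume g: "g \<in> vhom V W \<and> (\<forall>x\<in>S. g (gen x) = val x)"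
    show "g = restrict h (carrier V)"
    proof (rule vhom_eqI)
      show "g x = restrict h (carrier V) x" if "x \<in> carrier V" for x
        by (subst spanning_eq[OF assms(1,2) _ assms(5,3,4), of g x])
          (use g that assms(6) in \<open>auto simp: vhom_def\<close>)
    qed (use g restrict_vhom[OF assms(1,5)] in auto)
  qed
  from theI'[OF this] show "lin_ext V W S gen val \<in> vhom V W"
    and "x \<in> S \<Longrightarrow> lin_ext V W S gen val (gen x) = val x"
    by (auto simp: lin_ext_def)
qed

subsection \<open>Constructions\<close>

lemma cvs_complex_vs: "cvs complex_vs"
  by (rule cvsI) (auto simp: complex_vs_def algebra_simps)

lemma cvs_zero_vs: "cvs zero_vs"
  by (rule cvsI) (auto simp: zero_vs_def)

lemma cvs_prod_vs:
  assumes "\<And>i. i \<in> I \<Longrightarrow> cvs (V i)"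
  shows "cvs (prod_vs I V)"
proof -
  have *: "abelian_group (V i)" if "i \<in> I" for i
    using assms[OF that] by (simp add: module_def)
  have **: "abelian_monoid (V i)" if "i \<in> I" for i
    using *[OF that] by (simp add: abelian_group_def)
  note ab = abelian_groupE[OF *] abelian_monoid.a_lcomm[OF **] abelian_monoid.r_zero[OF **]
  show ?thesis
    unfolding prod_vs_def
    by (rule cvsI)
      (auto simp: PiE_iff fun_eq_iff extensional_def ab
        module.smult_closed[OF assms, simplified] module.smult_l_distr[OF assms, simplified]
        module.smult_r_distr[OF assms, simplified] module.smult_assoc1[OF assms, simplified]
        module.smult_one[OF assms, simplified] module.smult_l_null[OF assms, simplified])
qed

lemma submodule_dsum:
  assumes "\<And>i. i \<in> I \<Longrightarrow> cvs (V i)"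
  shows "submodule {x \<in> carrier (prod_vs I V). finite {i \<in> I. x i \<noteq> \<zero>\<^bsub>V i\<^esub>}} complex_field (prod_vs I V)"
proof -
  have *: "abelian_group (V i)" if "i \<in> I" for i
    using assms[OF that] by (simp add: module_def)
  note ab = abelian_groupE[OF *]
  interpret P: module complex_field "prod_vs I V" by (rule cvs_prod_vs) fact
  show ?thesis
  proof (rule cvs_submoduleI)
    show "cvs (prod_vs I V)" by (rule P.module_axioms)
    fix x y assume xy: "x \<in> {x \<in> carrier (prod_vs I V). finite {i \<in> I. x i \<noteq> \<zero>\<^bsub>V i\<^esub>}}"
      "y \<in> {x \<in> carrier (prod_vs I V). finite {i \<in> I. x i \<noteq> \<zero>\<^bsub>V i\<^esub>}}"
    have "{i \<in> I. (x \<oplus>\<^bsub>prod_vs I V\<^esub> y) i \<noteq> \<zero>\<^bsub>V i\<^esub>} \<subseteq> {i \<in> I. x i \<noteq> \<zero>\<^bsub>V i\<^esub>} \<union> {i \<in> I. y i \<noteq> \<zero>\<^bsub>V i\<^esub>}"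
      using ab by (auto simp: prod_vs_def)
    with xy show "x \<oplus>\<^bsub>prod_vs I V\<^esub> y \<in> {x \<in> carrier (prod_vs I V). finite {i \<in> I. x i \<noteq> \<zero>\<^bsub>V i\<^esub>}}"
      using finite_subset by auto
    fix c
    have "{i \<in> I. (c \<odot>\<^bsub>prod_vs I V\<^esub> x) i \<noteq> \<zero>\<^bsub>V i\<^esub>} \<subseteq> {i \<in> I. x i \<noteq> \<zero>\<^bsub>V i\<^esub>}"
      using module.smult_r_null[OF assms] by (auto simp: prod_vs_def)
    with xy show "c \<odot>\<^bsub>prod_vs I V\<^esub> x \<in> {x \<in> carrier (prod_vs I V). finite {i \<in> I. x i \<noteq> \<zero>\<^bsub>V i\<^esub>}}"
      using finite_subset by auto
  qed (auto simp: prod_vs_def ab)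
qed

lemma cvs_dsum_vs:
  assumes "\<And>i. i \<in> I \<Longrightarrow> cvs (V i)"
  shows "cvs (dsum_vs I V)"
  unfolding dsum_vs_def
  by (rule submodule.submodule_is_module[OF submodule_dsum cvs_prod_vs]) (use assms in auto)

lemma cvs_hom_vs:
  assumes "cvs V" "cvs W"
  shows "cvs (hom_vs V W)"
proof -
  interpret V: module complex_field V by fact
  interpret W: module complex_field W by fact
  note res = restrict_vhom[OF assms(1)]
  have cl: "f x \<in> carrier W" if "f \<in> vhom V W" "x \<in> carrier V" for f x
    using that vhomD lin_map_closed by metis
  have ext: "f \<in> extensional (carrier V)" if "f \<in> vhom V W" for f
    using that vhomD by metis
  show ?thesis
    unfolding hom_vs_def
    by (rule cvsI)
      (auto intro!: res lin_map_zero_map lin_map_add_map lin_map_smult_map assms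
        extensionalityI[of _ "carrier V"] intro: ext vhomD(2)
        simp: cl W.add.m_ac W.smult_l_distr[simplified] W.smult_r_distr[simplified]
        W.smult_assoc1[simplified] W.smult_one[simplified] W.smult_l_null[simplified])
qed

subsection \<open>Direct sums\<close>

lemma dsum_carrier:
  "x \<in> carrier (dsum_vs I V) \<longleftrightarrow>
    x \<in> (\<Pi>\<^sub>E i\<in>I. carrier (V i)) \<and> finite {i \<in> I. x i \<noteq> \<zero>\<^bsub>V i\<^esub>}"
  by (simp add: dsum_vs_def prod_vs_def)

lemma dsum_ops [simp]:
  "x \<oplus>\<^bsub>dsum_vs I V\<^esub> y = (\<lambda>i\<in>I. x i \<oplus>\<^bsub>V i\<^esub> y i)"
  "c \<odot>\<^bsub>dsum_vs I V\<^esub> x = (\<lambda>i\<in>I. c \<odot>\<^bsub>V i\<^esub> x i)"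
  "\<zero>\<^bsub>dsum_vs I V\<^esub> = (\<lambda>i\<in>I. \<zero>\<^bsub>V i\<^esub>)"
  by (simp_all add: dsum_vs_def prod_vs_def)

lemma lin_map_dsum_in:
  assumes "\<And>i. i \<in> I \<Longrightarrow> cvs (V i)" "i \<in> I"
  shows "lin_map (V i) (dsum_vs I V) (dsum_in I V i)"
proof (rule lin_mapI)
  have *: "abelian_group (V i)" if "i \<in> I" for i
    using assms(1)[OF that] by (simp add: module_def)
  note ab = abelian_groupE[OF *]
  fix x y assume x: "x \<in> carrier (V i)" and y: "y \<in> carrier (V i)"
  have "{j \<in> I. dsum_in I V i x j \<noteq> \<zero>\<^bsub>V j\<^esub>} \<subseteq> {i}" by (auto simp: dsum_in_def)
  with x show "dsum_in I V i x \<in> carrier (dsum_vs I V)"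
    by (auto simp: dsum_carrier dsum_in_def ab dest: finite_subset)
  show "dsum_in I V i (x \<oplus>\<^bsub>V i\<^esub> y) = dsum_in I V i x \<oplus>\<^bsub>dsum_vs I V\<^esub> dsum_in I V i y"
    using ab by (auto simp: dsum_in_def fun_eq_iff)
  show "dsum_in I V i (c \<odot>\<^bsub>V i\<^esub> x) = c \<odot>\<^bsub>dsum_vs I V\<^esub> dsum_in I V i x" for c
    using module.smult_r_null[OF assms(1)] by (auto simp: dsum_in_def fun_eq_iff)
qed

lemma dsum_in_closed:
  assumes "\<And>i. i \<in> I \<Longrightarrow> cvs (V i)" "i \<in> I" "x \<in> carrier (V i)"
  shows "dsum_in I V i x \<in> carrier (dsum_vs I V)"
  by (rule lin_map_closed[OF lin_map_dsum_in]) (use assms in auto)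

text \<open>Each element of the direct sum is reached by induction on a finite set containing its
  support.\<close>

lemma dsum_spanning:
  assumes V: "\<And>i. i \<in> I \<Longrightarrow> cvs (V i)"
    and B: "\<And>i x. i \<in> I \<Longrightarrow> x \<in> carrier (V i) \<Longrightarrow> dsum_in I V i x \<in> vspan (dsum_vs I V) B"
    and Bc: "B \<subseteq> carrier (dsum_vs I V)"
  shows "carrier (dsum_vs I V) \<subseteq> vspan (dsum_vs I V) B"
proof
  let ?S = "dsum_vs I V"
  interpret S: module complex_field ?S by (rule cvs_dsum_vs) fact
  have *: "abelian_group (V i)" if "i \<in> I" for i
    using V[OF that] by (simp add: module_def)
  note ab = abelian_groupE[OF *]
  have sub: "submodule (vspan ?S B) complex_field ?S"
    by (rule submodule_vspan[OF S.module_axioms Bc])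
  fix x assume "x \<in> carrier ?S"
  moreover have "x \<in> vspan ?S B"
    if "finite F" "x \<in> (\<Pi>\<^sub>E i\<in>I. carrier (V i))" "{i \<in> I. x i \<noteq> \<zero>\<^bsub>V i\<^esub>} \<subseteq> F" for F x
    using that
  proof (induction F arbitrary: x)
    case empty
    then have "x = \<zero>\<^bsub>?S\<^esub>" by (auto simp: fun_eq_iff PiE_iff extensional_def)
    then show ?case using submodule_zero[OF sub] by (simp del: dsum_ops)
  next
    case (insert i F)
    show ?case
    proof (cases "i \<in> I")
      case True
      let ?y = "x(i := \<zero>\<^bsub>V i\<^esub>)"
      have "?y \<in> vspan ?S B"
        by (rule insert.IH) (use insert.prems True ab(2) in \<open>auto simp: PiE_iff extensional_def\<close>)
      moreover have "dsum_in I V i (x i) \<in> vspan ?S B"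
        by (rule B) (use insert.prems True in auto)
      moreover have "x = dsum_in I V i (x i) \<oplus>\<^bsub>?S\<^esub> ?y"
        using insert.prems True ab abelian_monoid.r_zero[OF abelian_group.axioms(1)[OF *]]
        by (auto simp: fun_eq_iff dsum_in_def PiE_iff extensional_def)
      ultimately show ?thesis using S.submoduleE(5)[OF sub] by metis
    next
      case False
      then show ?thesis using insert.prems by (intro insert.IH) auto
    qed
  qed
  ultimately show "x \<in> vspan ?S B" by (auto simp: dsum_carrier)
qed

lemma dsum_lift:
  assumes V: "\<And>i. i \<in> I \<Longrightarrow> cvs (V i)" and W: "cvs W"
    and h: "\<And>i. i \<in> I \<Longrightarrow> lin_map (V i) W (h i)"
  obtains g where "lin_map (dsum_vs I V) W g"
    and "\<And>i x. i \<in> I \<Longrightarrow> x \<in> carrier (V i) \<Longrightarrow> g (dsum_in I V i x) = h i x"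
proof -
  interpret W: module complex_field W by fact
  have h0: "h i \<zero>\<^bsub>V i\<^esub> = \<zero>\<^bsub>W\<^esub>" if "i \<in> I" for i
    using lin_map_zero[OF V W h] that by auto
  \<comment> \<open>\<open>g\<close> sums over the support, but any larger finite set of indices gives the same value; this
    makes additivity visible, where the supports of \<open>x\<close>, \<open>y\<close> and \<open>x + y\<close> may all differ.\<close>
  define supp where "supp x = {i \<in> I. x i \<noteq> \<zero>\<^bsub>V i\<^esub>}" for x
  define g where "g x = (\<Oplus>\<^bsub>W\<^esub>i\<in>supp x. h i (x i))" for x
  have cl: "h i (x i) \<in> carrier W" if "x \<in> carrier (dsum_vs I V)" "i \<in> I" for x i
    using that lin_map_closed[OF h] by (auto simp: dsum_carrier PiE_iff)
  have g_eq: "g x = (\<Oplus>\<^bsub>W\<^esub>i\<in>F. h i (x i))"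
    if "x \<in> carrier (dsum_vs I V)" "finite F" "supp x \<subseteq> F" "F \<subseteq> I" for x F
    unfolding g_def
    by (rule W.add.finprod_mono_neutral_cong_left) (use that cl h0 in \<open>auto simp: supp_def\<close>)
  have fin: "finite (supp x)" "supp x \<subseteq> I" if "x \<in> carrier (dsum_vs I V)" for x
    using that by (auto simp: supp_def dsum_carrier)
  interpret S: module complex_field "dsum_vs I V" by (rule cvs_dsum_vs) fact
  show thesis
  proof
    show "lin_map (dsum_vs I V) W g"
    proof (rule lin_mapI)
      fix x y assume x: "x \<in> carrier (dsum_vs I V)" and y: "y \<in> carrier (dsum_vs I V)"
      then show "g x \<in> carrier W"
        unfolding g_def using cl[OF x] fin(2)[OF x] by (intro W.finsum_closed) auto
      let ?F = "supp x \<union> supp y"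
      have F: "finite ?F" "?F \<subseteq> I" using fin x y by auto
      have *: "supp (x \<oplus>\<^bsub>dsum_vs I V\<^esub> y) \<subseteq> ?F"
        using abelian_groupE(5)[OF module.axioms(2)[OF V]]
          abelian_groupE(2)[OF module.axioms(2)[OF V]]
        by (auto simp: supp_def)
      have "g (x \<oplus>\<^bsub>dsum_vs I V\<^esub> y) = (\<Oplus>\<^bsub>W\<^esub>i\<in>?F. h i ((x \<oplus>\<^bsub>dsum_vs I V\<^esub> y) i))"
        by (rule g_eq[OF _ F(1) * F(2)]) (use x y in \<open>auto simp del: dsum_ops\<close>)
      also have "\<dots> = (\<Oplus>\<^bsub>W\<^esub>i\<in>?F. h i (x i) \<oplus>\<^bsub>W\<^esub> h i (y i))"
        by (rule W.finsum_cong')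
          (use x y F cl in \<open>auto simp: dsum_carrier PiE_iff lin_map_add[OF h] subset_iff\<close>)
      also have "\<dots> = g x \<oplus>\<^bsub>W\<^esub> g y"
        using x y F cl g_eq[OF x F(1) _ F(2)] g_eq[OF y F(1) _ F(2)]
        by (subst W.finsum_addf) auto
      finally show "g (x \<oplus>\<^bsub>dsum_vs I V\<^esub> y) = g x \<oplus>\<^bsub>W\<^esub> g y" .
    next
      fix c x assume x: "x \<in> carrier (dsum_vs I V)"
      note F = fin[OF x]
      have *: "supp (c \<odot>\<^bsub>dsum_vs I V\<^esub> x) \<subseteq> supp x"
        using module.smult_r_null[OF V] by (auto simp: supp_def)
      have "g (c \<odot>\<^bsub>dsum_vs I V\<^esub> x) = (\<Oplus>\<^bsub>W\<^esub>i\<in>supp x. h i ((c \<odot>\<^bsub>dsum_vs I V\<^esub> x) i))"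
        by (rule g_eq[OF _ F(1) * F(2)]) (use x in \<open>auto simp del: dsum_ops\<close>)
      also have "\<dots> = (\<Oplus>\<^bsub>W\<^esub>i\<in>supp x. c \<odot>\<^bsub>W\<^esub> h i (x i))"
        by (rule W.finsum_cong')
          (use x F cl in \<open>auto simp: dsum_carrier PiE_iff lin_map_smult[OF h] subset_iff\<close>)
      also have "\<dots> = c \<odot>\<^bsub>W\<^esub> g x"
        unfolding g_def using x F cl by (subst W.finsum_smult_ldistr) auto
      finally show "g (c \<odot>\<^bsub>dsum_vs I V\<^esub> x) = c \<odot>\<^bsub>W\<^esub> g x" .
    qed
  next
    fix i x assume i: "i \<in> I" and x: "x \<in> carrier (V i)"
    have "g (dsum_in I V i x) = (\<Oplus>\<^bsub>W\<^esub>j\<in>{i}. h j (dsum_in I V i x j))"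
      by (rule g_eq) (use i x V in \<open>auto simp: supp_def dsum_in_def
        intro!: dsum_in_closed[unfolded dsum_in_def]\<close>)
    also have "\<dots> = h i x"
      using lin_map_closed[OF h[OF i] x] i
      by (subst W.finsum_insert) (auto simp: dsum_in_def)
    finally show "g (dsum_in I V i x) = h i x" .
  qed
qed

subsection \<open>Quotients\<close>

lemma quot_ops:
  "carrier (quot_vs V H) = {H +>\<^bsub>V\<^esub> x | x. x \<in> carrier V}"
  "\<zero>\<^bsub>quot_vs V H\<^esub> = H" "K \<oplus>\<^bsub>quot_vs V H\<^esub> L = K <+>\<^bsub>V\<^esub> L"
  "c \<odot>\<^bsub>quot_vs V H\<^esub> K = (\<Union>x\<in>K. H +>\<^bsub>V\<^esub> (c \<odot>\<^bsub>V\<^esub> x))"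
  by (auto simp: quot_vs_def A_RCOSETS_def')

text \<open>A vector space with a subspace \<open>H\<close>; the cosets \<open>H + x\<close> are the elements of \<open>quot_vs V H\<close>.\<close>

locale cvs_quot = module complex_field V for V :: "(complex, 'v) module" (structure) +
  fixes H
  assumes sub: "submodule H complex_field V"
begin

lemma abelian_subgroup_H: "abelian_subgroup H V"
proof (rule abelian_subgroupI3)
  show "additive_subgroup H V"
    using sub by (simp add: additive_subgroup_def submodule_def)
qed (rule M.abelian_group_axioms)

interpretation AS: abelian_subgroup H V by (rule abelian_subgroup_H)

lemma coset_eq_iff:
  assumes "x \<in> carrier V" "y \<in> carrier V"
  shows "H +> x = H +> y \<longleftrightarrow> x \<ominus> y \<in> H"
  unfolding a_minus_def AS.a_rcos_module[OF assms(2,1), symmetric]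
  using assms AS.a_repr_independence' AS.a_rcos_self by metis

lemma coset_self: "x \<in> carrier V \<Longrightarrow> x \<in> H +> x"
  by (rule AS.a_rcos_self)

lemma in_cosetD:
  assumes "y \<in> H +> x" "x \<in> carrier V"
  shows "y \<in> carrier V" "H +> y = H +> x"
  using assms AS.a_repr_independence' AS.a_elemrcos_carrier by (metis, metis)

lemma coset_add: "x \<in> carrier V \<Longrightarrow> y \<in> carrier V \<Longrightarrow> (H +> x) <+> (H +> y) = H +> (x \<oplus> y)"
  by (rule AS.a_rcos_sum)

lemma coset_smult:
  assumes x: "x \<in> carrier V"
  shows "(\<Union>y\<in>H +> x. H +> (c \<odot> y)) = H +> (c \<odot> x)"
proof -
  have "H +> (c \<odot> y) = H +> (c \<odot> x)" if "y \<in> H +> x" for y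
  proof -
    note y = in_cosetD[OF that x]
    have "x \<in> carrier V" "y \<in> carrier V" "y \<ominus> x \<in> H"
      using coset_eq_iff[OF y(1) x] x y by auto
    moreover have "c \<odot> y \<ominus> c \<odot> x = c \<odot> (y \<ominus> x)"
      using y x by (simp add: a_minus_def smult_r_distr smult_r_minus)
    ultimately show ?thesis
      using coset_eq_iff submoduleE(4)[OF sub] by simp
  qed
  then show ?thesis using coset_self[OF x] by blast
qed

lemma coset_zero: "H +> \<zero> = H"
  using AS.a_rcos_const[OF submodule_zero[OF sub]] .

lemma coset_ops:
  assumes "x \<in> carrier V"
  shows "H +> x \<in> carrier (quot_vs V H)"
    and "y \<in> carrier V \<Longrightarrow> (H +> x) \<oplus>\<^bsub>quot_vs V H\<^esub> (H +> y) = H +> (x \<oplus> y)"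
    and "c \<odot>\<^bsub>quot_vs V H\<^esub> (H +> x) = H +> (c \<odot> x)"
    and "\<zero>\<^bsub>quot_vs V H\<^esub> = H +> \<zero>"
  using assms by (auto simp: quot_ops coset_add coset_smult coset_zero)

lemma quot_carrierE:
  assumes "K \<in> carrier (quot_vs V H)"
  obtains x where "x \<in> carrier V" "K = H +> x"
  using assms by (auto simp: quot_ops)

lemma cvs_quot: "cvs (quot_vs V H)"
  by (rule cvsI)
    (auto elim!: quot_carrierE simp: coset_ops coset_ops(4)[OF zero_closed] a_ac
      smult_l_distr[simplified] smult_r_distr[simplified] smult_assoc1[simplified]
      smult_one[simplified] smult_l_null[simplified])

lemma lin_map_coset: "lin_map V (quot_vs V H) (\<lambda>x. H +> x)"
  by (rule lin_mapI) (auto simp: coset_ops)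

lemma quot_lift:
  assumes W: "cvs W" and h: "lin_map V W h" and null: "\<And>x. x \<in> H \<Longrightarrow> h x = \<zero>\<^bsub>W\<^esub>"
  obtains g where "lin_map (quot_vs V H) W g" "\<And>x. x \<in> carrier V \<Longrightarrow> g (H +> x) = h x"
proof -
  interpret W: module complex_field W by fact
  define g where "g K = h (SOME x. x \<in> K)" for K
  have g: "g (H +> x) = h x" if x: "x \<in> carrier V" for x
  proof -
    define y where "y = (SOME y. y \<in> H +> x)"
    have "y \<in> H +> x" unfolding y_def using coset_self[OF x] by (rule someI)
    note y = in_cosetD[OF this x]
    then have "h (y \<ominus> x) = \<zero>\<^bsub>W\<^esub>" using null coset_eq_iff x by auto
    then have "h y \<ominus>\<^bsub>W\<^esub> h x = \<zero>\<^bsub>W\<^esub>"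
      using lin_map_minus[OF module_axioms W h y(1) x] by simp
    then show ?thesis
      using lin_map_closed[OF h] x y W.minus_equality[of "h y" "\<ominus>\<^bsub>W\<^esub> h x"]
      by (simp add: g_def a_minus_def flip: y_def)
  qed
  have "lin_map (quot_vs V H) W g"
    by (rule lin_mapI) (auto elim!: quot_carrierE simp: coset_ops g lin_mapD[OF h])
  then show thesis using g that by blast
qed

end

lemma vspan_quot_lift:
  assumes "cvs V" "cvs W" "B \<subseteq> carrier V" "lin_map V W h" "\<And>x. x \<in> B \<Longrightarrow> h x = \<zero>\<^bsub>W\<^esub>"
  obtains g where "lin_map (quot_vs V (vspan V B)) W g"
    "\<And>x. x \<in> carrier V \<Longrightarrow> g (vspan V B +>\<^bsub>V\<^esub> x) = h x"
proof -
  interpret V: module complex_field V by fact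
  interpret cvs_quot V "vspan V B"
    by (intro cvs_quot.intro cvs_quot_axioms.intro submodule_vspan assms)
  have "vspan V B \<subseteq> {x \<in> carrier V. h x = \<zero>\<^bsub>W\<^esub>}"
    by (rule vspan_minimal[OF submodule_equalizer[OF assms(1,2,4) lin_map_zero_map[OF assms(2)]]])
      (use assms in auto)
  then show thesis using quot_lift[OF assms(2,4)] that by blast
qed

section \<open>Tensor powers and multilinear maps\<close>

lemma cvs_free_vs: "cvs (free_vs S)"
  unfolding free_vs_def by (rule cvs_dsum_vs) (rule cvs_complex_vs)

lemma free_basis_closed: "x \<in> S \<Longrightarrow> free_basis S x \<in> carrier (free_vs S)"
  unfolding free_vs_def free_basis_def
  by (rule dsum_in_closed) (auto simp: cvs_complex_vs, simp add: complex_vs_def)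

lemma dsum_in_complex:
  "dsum_in S (\<lambda>_. complex_vs) x c = c \<odot>\<^bsub>free_vs S\<^esub> free_basis S x"
  by (auto simp: free_vs_def free_basis_def dsum_in_def complex_vs_def fun_eq_iff)

lemma free_spanning: "carrier (free_vs S) \<subseteq> vspan (free_vs S) (free_basis S ` S)"
proof -
  interpret F: module complex_field "free_vs S" by (rule cvs_free_vs)
  have B: "free_basis S ` S \<subseteq> carrier (free_vs S)" using free_basis_closed by auto
  have sub: "submodule (vspan (free_vs S) (free_basis S ` S)) complex_field (free_vs S)"
    by (rule submodule_vspan[OF cvs_free_vs B])
  have "dsum_in S (\<lambda>_. complex_vs) x c \<in> vspan (free_vs S) (free_basis S ` S)" if "x \<in> S" for x c
    unfolding dsum_in_complex
    by (rule F.submoduleE(4)[OF sub]) (use that vspan_superset in force)+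
  then show ?thesis
    using B unfolding free_vs_def by (intro dsum_spanning) (auto simp: cvs_complex_vs)
qed

lemma free_lift:
  assumes W: "cvs W" and val: "\<And>x. x \<in> S \<Longrightarrow> val x \<in> carrier W"
  obtains g where "lin_map (free_vs S) W g" "\<And>x. x \<in> S \<Longrightarrow> g (free_basis S x) = val x"
proof -
  interpret W: module complex_field W by fact
  have lin: "lin_map complex_vs W (\<lambda>c. c \<odot>\<^bsub>W\<^esub> val x)" if "x \<in> S" for x
    by (rule lin_mapI)
      (use val[OF that] W.smult_l_distr[simplified] W.smult_assoc1[simplified] in
        \<open>auto simp: complex_vs_def\<close>)
  obtain g where "lin_map (dsum_vs S (\<lambda>_. complex_vs)) W g"
    and g: "\<And>x c. x \<in> S \<Longrightarrow> c \<in> carrier complex_vs \<Longrightarrow>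
      g (dsum_in S (\<lambda>_. complex_vs) x c) = c \<odot>\<^bsub>W\<^esub> val x"
    using dsum_lift[of S "\<lambda>_. complex_vs" W "\<lambda>x c. c \<odot>\<^bsub>W\<^esub> val x", OF cvs_complex_vs W lin] by blast
  moreover have "g (free_basis S x) = val x" if "x \<in> S" for x
    using g[OF that, of 1] val[OF that] W.smult_one[of "val x"]
    by (simp add: free_basis_def complex_vs_def)
  ultimately show thesis using that by (simp add: free_vs_def)
qed

text \<open>Multilinearity of \<open>u\<close> on families \<open>I \<rightarrow> A\<close>: \<open>u\<close> takes values in \<open>W\<close>, and it is linear in each
  coordinate while the others are held fixed. Only the values of \<open>u\<close> on families matter.\<close>

definition multilinear :: "(complex, 'a) module \<Rightarrow> 'i set \<Rightarrow> (complex, 'w) module \<Rightarrow>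
    (('i \<Rightarrow> 'a) \<Rightarrow> 'w) \<Rightarrow> bool" where
  "multilinear A I W u \<longleftrightarrow> (\<forall>a\<in>families A I. u a \<in> carrier W) \<and>
     (\<forall>a\<in>families A I. \<forall>i\<in>I. lin_map A W (\<lambda>x. u (a(i := x))))"

lemma families_upd: "a \<in> families A I \<Longrightarrow> i \<in> I \<Longrightarrow> x \<in> carrier A \<Longrightarrow> a(i := x) \<in> families A I"
  by (auto simp: families_def PiE_iff extensional_def)

lemma families_nth: "a \<in> families A I \<Longrightarrow> i \<in> I \<Longrightarrow> a i \<in> carrier A"
  by (auto simp: families_def)

context
  fixes A :: "(complex, 'a) module" and I :: "'i set"
  assumes A: "cvs A"
begin

interpretation A: module complex_field A by (rule A)

interpretation F: module complex_field "free_vs (families A I)" by (rule cvs_free_vs)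

lemma multilin_rel_closed: "multilin_rel A I \<subseteq> carrier (free_vs (families A I))"
  by (auto simp: multilin_rel_def Let_def families_upd intro!: free_basis_closed F.minus_closed
    F.a_closed F.smult_closed)

interpretation cvs_quot "free_vs (families A I)" "tensor_kernel A I"
  unfolding tensor_kernel_def
  by (intro cvs_quot.intro cvs_quot_axioms.intro submodule_vspan cvs_free_vs multilin_rel_closed)

lemma cvs_tpow: "cvs (tpow A I)"
  unfolding tpow_def by (rule cvs_quot)

lemma pure_tensor_closed: "a \<in> families A I \<Longrightarrow> pure_tensor A I a \<in> carrier (tpow A I)"
  unfolding tpow_def pure_tensor_def by (rule coset_ops) (rule free_basis_closed)

lemma pure_tensor_multilinear: "multilinear A I (tpow A I) (pure_tensor A I)"
proof -
  let ?e = "free_basis (families A I)" and ?K = "tensor_kernel A I"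
  let ?F = "free_vs (families A I)"
  have rel: "multilin_rel A I \<subseteq> ?K" unfolding tensor_kernel_def by (rule vspan_superset)
  have e: "?e (a(i := x)) \<in> carrier ?F" if "a \<in> families A I" "i \<in> I" "x \<in> carrier A" for a i x
    using that by (intro free_basis_closed families_upd)
  have "lin_map A (tpow A I) (\<lambda>x. pure_tensor A I (a(i := x)))"
    if a: "a \<in> families A I" and i: "i \<in> I" for a i
  proof (rule lin_mapI)
    fix x y assume x: "x \<in> carrier A" and y: "y \<in> carrier A"
    show "pure_tensor A I (a(i := x)) \<in> carrier (tpow A I)"
      using a i x by (intro pure_tensor_closed families_upd)
    have "?e (a(i := x \<oplus>\<^bsub>A\<^esub> y)) \<ominus>\<^bsub>?F\<^esub> (?e (a(i := x)) \<oplus>\<^bsub>?F\<^esub> ?e (a(i := y))) \<in> multilin_rel A I"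
      unfolding multilin_rel_def Let_def using a i x y by blast
    then have "?K +>\<^bsub>?F\<^esub> ?e (a(i := x \<oplus>\<^bsub>A\<^esub> y)) = ?K +>\<^bsub>?F\<^esub> (?e (a(i := x)) \<oplus>\<^bsub>?F\<^esub> ?e (a(i := y)))"
      using rel by (subst coset_eq_iff) (use e a i x y in auto)
    then show "pure_tensor A I (a(i := x \<oplus>\<^bsub>A\<^esub> y)) =
        pure_tensor A I (a(i := x)) \<oplus>\<^bsub>tpow A I\<^esub> pure_tensor A I (a(i := y))"
      using e[OF a i] x y by (simp add: pure_tensor_def tpow_def coset_ops)
  next
    fix c x assume x: "x \<in> carrier A"
    have "?e (a(i := c \<odot>\<^bsub>A\<^esub> x)) \<ominus>\<^bsub>?F\<^esub> (c \<odot>\<^bsub>?F\<^esub> ?e (a(i := x))) \<in> multilin_rel A I"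
      unfolding multilin_rel_def Let_def using a i x by blast
    then have "?K +>\<^bsub>?F\<^esub> ?e (a(i := c \<odot>\<^bsub>A\<^esub> x)) = ?K +>\<^bsub>?F\<^esub> (c \<odot>\<^bsub>?F\<^esub> ?e (a(i := x)))"
      using rel by (subst coset_eq_iff) (use e a i x in auto)
    then show "pure_tensor A I (a(i := c \<odot>\<^bsub>A\<^esub> x)) = c \<odot>\<^bsub>tpow A I\<^esub> pure_tensor A I (a(i := x))"
      using e[OF a i] x by (simp add: pure_tensor_def tpow_def coset_ops)
  qed
  then show ?thesis
    by (simp add: multilinear_def pure_tensor_closed)
qed

lemma lin_map_pure_tensor:
  "a \<in> families A I \<Longrightarrow> i \<in> I \<Longrightarrow> lin_map A (tpow A I) (\<lambda>x. pure_tensor A I (a(i := x)))"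
  using pure_tensor_multilinear by (auto simp: multilinear_def)

lemma pure_tensor_spanning:
  "carrier (tpow A I) \<subseteq> vspan (tpow A I) (pure_tensor A I ` families A I)"
proof -
  let ?F = "free_vs (families A I)"
  have "carrier (tpow A I) \<subseteq>
      vspan (tpow A I) ((\<lambda>x. tensor_kernel A I +>\<^bsub>?F\<^esub> x) ` free_basis (families A I) ` families A I)"
    unfolding tpow_def
    by (rule spanning_image[OF cvs_free_vs cvs_quot lin_map_coset _ free_spanning])
      (auto elim!: quot_carrierE intro!: free_basis_closed)
  then show ?thesis by (simp add: image_image pure_tensor_def)
qed

text \<open>The universal property of the tensor power: multilinear maps factor through pure tensors.\<close>

lemma tpow_lift:
  assumes W: "cvs W" and u: "multilinear A I W u"
  obtains g where "lin_map (tpow A I) W g" "\<And>a. a \<in> families A I \<Longrightarrow> g (pure_tensor A I a) = u a"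
proof -
  let ?F = "free_vs (families A I)"
  interpret W: module complex_field W by (rule W)
  obtain h where h: "lin_map ?F W h" and hu: "\<And>a. a \<in> families A I \<Longrightarrow> h (free_basis (families A I) a) = u a"
    using free_lift[of W "families A I" u] W u by (auto simp: multilinear_def)
  have cl: "u a \<in> carrier W" if "a \<in> families A I" for a
    using u that by (simp add: multilinear_def)
  have lin: "lin_map A W (\<lambda>x. u (a(i := x)))" if "a \<in> families A I" "i \<in> I" for a i
    using u that by (simp add: multilinear_def)
  have self: "x \<ominus>\<^bsub>W\<^esub> x = \<zero>\<^bsub>W\<^esub>" if "x \<in> carrier W" for x
    using that by (simp add: a_minus_def W.r_neg)
  have "h x = \<zero>\<^bsub>W\<^esub>" if "x \<in> multilin_rel A I" for x
    using that
    by (auto simp: multilin_rel_def Let_def lin_map_minus[OF cvs_free_vs W h] lin_mapD[OF h]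
        free_basis_closed families_upd hu lin_map_add[OF lin] lin_map_smult[OF lin] cl self)
  from vspan_quot_lift[OF cvs_free_vs W multilin_rel_closed h this]
  obtain g where "lin_map (tpow A I) W g"
    "\<And>x. x \<in> carrier ?F \<Longrightarrow> g (tensor_kernel A I +>\<^bsub>?F\<^esub> x) = h x"
    unfolding tpow_def tensor_kernel_def by blast
  then show thesis using that by (simp add: pure_tensor_def free_basis_closed hu)
qed

lemma tpow_eqI:
  assumes "cvs W" "lin_map (tpow A I) W g" "lin_map (tpow A I) W h"
    and "\<And>a. a \<in> families A I \<Longrightarrow> g (pure_tensor A I a) = h (pure_tensor A I a)"
    and "x \<in> carrier (tpow A I)"
  shows "g x = h x"
  by (rule spanning_eq[OF cvs_tpow assms(1-3) pure_tensor_spanning])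
    (use assms pure_tensor_closed in auto)

lemma tpow_lin_ext:
  assumes "cvs W" "multilinear A I W u"
  shows "lin_ext (tpow A I) W (families A I) (pure_tensor A I) u \<in> vhom (tpow A I) W"
    and "a \<in> families A I \<Longrightarrow>
      lin_ext (tpow A I) W (families A I) (pure_tensor A I) u (pure_tensor A I a) = u a"
proof -
  obtain g where "lin_map (tpow A I) W g" "\<And>a. a \<in> families A I \<Longrightarrow> g (pure_tensor A I a) = u a"
    using tpow_lift[OF assms] by blast
  note * = lin_ext_spec[OF cvs_tpow assms(1) pure_tensor_spanning _ this]
  show "lin_ext (tpow A I) W (families A I) (pure_tensor A I) u \<in> vhom (tpow A I) W"
    and "a \<in> families A I \<Longrightarrow>
      lin_ext (tpow A I) W (families A I) (pure_tensor A I) u (pure_tensor A I a) = u a"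
    using * pure_tensor_closed by auto
qed

end

section \<open>Derivations and the functor on \<open>\<Gamma>\<close>\<close>

text \<open>The family \<open>b\<close> with \<open>b\<^sub>j = \<Prod>\<^bsub>\<phi>(i) = j\<^esub> a\<^sub>i\<close>, that is, the action of \<open>\<phi> : I \<rightarrow> J\<close> on pure
  tensors. It is undefined outside \<open>J\<close>, as a member of \<open>families A J\<close> must be.\<close>

definition fibre_prod :: "(complex, 'a) module \<Rightarrow> 'i set \<Rightarrow> 'j set \<Rightarrow> ('i \<Rightarrow> 'j) \<Rightarrow>
    ('i \<Rightarrow> 'a) \<Rightarrow> 'j \<Rightarrow> 'a" where
  "fibre_prod A I J \<phi> a = (\<lambda>j\<in>J. finprod A a {i \<in> I. \<phi> i = j})"

context
  fixes A :: "(complex, 'a) module"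
  assumes alg: "algebra complex_field A"
begin

lemma cvs_algebra: "cvs A"
  by (rule algebra.module[OF alg])

interpretation A: cring A by (rule algebra.M_cring[OF alg])

interpretation VA: module complex_field A by (rule cvs_algebra)

lemma fibre_prod_closed: "a \<in> families A I \<Longrightarrow> fibre_prod A I J \<phi> a \<in> families A J"
  by (auto simp: families_def fibre_prod_def intro!: A.finprod_closed)

text \<open>Changing the \<open>i\<close>-th entry of \<open>a\<close> only affects the product over the fibre through \<open>i\<close>, so
  multilinearity at \<open>i\<close> reduces to multilinearity of pure tensors at \<open>\<phi> i\<close>.\<close>

lemma fibre_prod_upd:
  assumes "finite I" "a \<in> families A I" "i \<in> I" "\<phi> i \<in> J" "x \<in> carrier A"
  shows "fibre_prod A I J \<phi> (a(i := x)) =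
    (fibre_prod A I J \<phi> a)(\<phi> i := finprod A (a(i := x)) {k \<in> I. \<phi> k = \<phi> i})"
proof
  fix j
  have "finprod A (a(i := x)) {k \<in> I. \<phi> k = j} = finprod A a {k \<in> I. \<phi> k = j}" if "j \<noteq> \<phi> i"
    by (rule A.finprod_cong') (use assms that in \<open>auto simp: families_def\<close>)
  then show "fibre_prod A I J \<phi> (a(i := x)) j =
    ((fibre_prod A I J \<phi> a)(\<phi> i := finprod A (a(i := x)) {k \<in> I. \<phi> k = \<phi> i})) j"
    using assms by (auto simp: fibre_prod_def)
qed

lemma finprod_upd_lin:
  assumes "finite S" "i \<in> S" "a \<in> S \<rightarrow> carrier A"
  shows "lin_map A A (\<lambda>x. finprod A (a(i := x)) S)"
proof -
  let ?p = "finprod A a (S - {i})"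
  have p: "?p \<in> carrier A" using assms by (intro A.finprod_closed) auto
  have eq: "finprod A (a(i := x)) S = x \<otimes>\<^bsub>A\<^esub> ?p" if "x \<in> carrier A" for x
  proof -
    have "insert i (S - {i}) = S" using assms by auto
    moreover have "finprod A (a(i := x)) (insert i (S - {i})) = x \<otimes>\<^bsub>A\<^esub> finprod A (a(i := x)) (S - {i})"
      using assms that by (subst A.finprod_insert) auto
    moreover have "finprod A (a(i := x)) (S - {i}) = ?p"
      by (rule A.finprod_cong') (use assms in auto)
    ultimately show ?thesis by simp
  qed
  show ?thesis
    using p eq by (intro lin_mapI)
      (simp_all add: A.l_distr algebra.smult_assoc2[OF alg, simplified])
qed

lemma fibre_prod_multilinear:
  assumes "finite I" "\<phi> \<in> I \<rightarrow> J"
  shows "multilinear A I (tpow A J) (\<lambda>a. pure_tensor A J (fibre_prod A I J \<phi> a))"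
  unfolding multilinear_def
proof (intro conjI ballI)
  fix a assume a: "a \<in> families A I"
  then show "pure_tensor A J (fibre_prod A I J \<phi> a) \<in> carrier (tpow A J)"
    by (intro pure_tensor_closed fibre_prod_closed cvs_algebra)
  fix i assume i: "i \<in> I"
  have "lin_map A A (\<lambda>x. finprod A (a(i := x)) {k \<in> I. \<phi> k = \<phi> i})"
    by (rule finprod_upd_lin) (use a i assms(1) in \<open>auto simp: families_def\<close>)
  moreover have "lin_map A (tpow A J) (\<lambda>x. pure_tensor A J ((fibre_prod A I J \<phi> a)(\<phi> i := x)))"
    by (rule lin_map_pure_tensor[OF cvs_algebra fibre_prod_closed[OF a]]) (use i assms(2) in auto)
  ultimately have "lin_map A (tpow A J)
      (\<lambda>x. pure_tensor A J ((fibre_prod A I J \<phi> a)(\<phi> i := finprod A (a(i := x)) {k \<in> I. \<phi> k = \<phi> i})))"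
    by (rule lin_map_compose)
  then show "lin_map A (tpow A J) (\<lambda>x. pure_tensor A J (fibre_prod A I J \<phi> (a(i := x))))"
    by (subst lin_map_cong[OF cvs_algebra])
      (use i assms(2) in \<open>auto simp only: fibre_prod_upd[OF assms(1) a i] funcset_mem\<close>)
qed

context
  fixes D
  assumes D: "is_derivation A D"
begin

lemma D_lin: "lin_map A A D"
  using D by (simp add: is_derivation_def)

lemma D_mult: "a \<in> carrier A \<Longrightarrow> b \<in> carrier A \<Longrightarrow>
    D (a \<otimes>\<^bsub>A\<^esub> b) = D a \<otimes>\<^bsub>A\<^esub> b \<oplus>\<^bsub>A\<^esub> a \<otimes>\<^bsub>A\<^esub> D b"
  using D by (simp add: is_derivation_def)

lemma D_closed: "a \<in> carrier A \<Longrightarrow> D a \<in> carrier A"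
  by (rule lin_map_closed[OF D_lin])

lemma D_one: "D \<one>\<^bsub>A\<^esub> = \<zero>\<^bsub>A\<^esub>"
proof -
  have "D \<one>\<^bsub>A\<^esub> = D \<one>\<^bsub>A\<^esub> \<oplus>\<^bsub>A\<^esub> D \<one>\<^bsub>A\<^esub>"
    using D_mult[of "\<one>\<^bsub>A\<^esub>" "\<one>\<^bsub>A\<^esub>"] D_closed by simp
  then show ?thesis using D_closed[of "\<one>\<^bsub>A\<^esub>"] by (metis A.one_closed A.add.l_cancel_one')
qed

text \<open>The Leibniz rule for products of any finite length, including the empty one, where it says
  \<open>D 1 = 0\<close>.\<close>

lemma D_finprod:
  assumes "finite S" "a \<in> S \<rightarrow> carrier A"
  shows "D (finprod A a S) = (\<Oplus>\<^bsub>A\<^esub>i\<in>S. finprod A (a(i := D (a i))) S)"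
  using assms
proof (induction S rule: finite_induct)
  case empty
  then show ?case by (simp add: D_one)
next
  case (insert s S)
  have as: "a s \<in> carrier A" and aS: "a \<in> S \<rightarrow> carrier A" using insert.prems by auto
  have P: "finprod A a S \<in> carrier A" using aS by (rule A.finprod_closed)
  have Pi: "finprod A (a(i := D (a i))) S \<in> carrier A" if "i \<in> S" for i
    using aS D_closed that by (intro A.finprod_closed) (auto simp: Pi_iff)
  have Q: "finprod A (a(i := D (a i))) (insert s S) \<in> carrier A" if "i \<in> insert s S" for i
    using insert.prems D_closed that by (intro A.finprod_closed) (auto simp: Pi_iff)
  have "D (finprod A a (insert s S)) = D (a s) \<otimes>\<^bsub>A\<^esub> finprod A a S \<oplus>\<^bsub>A\<^esub> a s \<otimes>\<^bsub>A\<^esub> D (finprod A a S)"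
    using insert.hyps as aS P by (simp add: D_mult)
  also have "a s \<otimes>\<^bsub>A\<^esub> D (finprod A a S) = (\<Oplus>\<^bsub>A\<^esub>i\<in>S. a s \<otimes>\<^bsub>A\<^esub> finprod A (a(i := D (a i))) S)"
    unfolding insert.IH[OF aS] by (rule A.finsum_rdistr) (use insert.hyps as Pi in auto)
  also have "\<dots> = (\<Oplus>\<^bsub>A\<^esub>i\<in>S. finprod A (a(i := D (a i))) (insert s S))"
  proof (rule A.finsum_cong')
    fix i assume i: "i \<in> S"
    then have "i \<noteq> s" using insert.hyps by auto
    then show "a s \<otimes>\<^bsub>A\<^esub> finprod A (a(i := D (a i))) S = finprod A (a(i := D (a i))) (insert s S)"
      using insert.hyps as aS D_closed i by (subst A.finprod_insert) (auto simp: Pi_iff)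
  next
    show "(\<lambda>i. finprod A (a(i := D (a i))) (insert s S)) \<in> S \<rightarrow> carrier A"
      using Q by blast
  qed simp
  also have "D (a s) \<otimes>\<^bsub>A\<^esub> finprod A a S = finprod A (a(s := D (a s))) (insert s S)"
  proof -
    have "finprod A (a(s := D (a s))) S = finprod A a S"
      by (rule A.finprod_cong') (use insert.hyps aS in auto)
    moreover have "finprod A (a(s := D (a s))) (insert s S) = D (a s) \<otimes>\<^bsub>A\<^esub> finprod A (a(s := D (a s))) S"
      using insert.hyps as aS D_closed by (subst A.finprod_insert) (auto simp: Pi_iff)
    ultimately show ?thesis by simp
  qed
  also have "finprod A (a(s := D (a s))) (insert s S) \<oplus>\<^bsub>A\<^esub> (\<Oplus>\<^bsub>A\<^esub>i\<in>S. finprod A (a(i := D (a i))) (insert s S))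
      = (\<Oplus>\<^bsub>A\<^esub>i\<in>insert s S. finprod A (a(i := D (a i))) (insert s S))"
    by (rule A.finsum_insert[symmetric]) (use insert.hyps Q in blast)+
  finally show ?case .
qed

lemma leibniz_multilinear:
  "multilinear A I (tpow A I) (\<lambda>a. \<Oplus>\<^bsub>tpow A I\<^esub>i\<in>I. pure_tensor A I (a(i := D (a i))))"
  unfolding multilinear_def
proof (intro conjI ballI)
  interpret T: module complex_field "tpow A I" by (rule cvs_tpow[OF cvs_algebra])
  fix a assume a: "a \<in> families A I"
  then show "(\<Oplus>\<^bsub>tpow A I\<^esub>i\<in>I. pure_tensor A I (a(i := D (a i)))) \<in> carrier (tpow A I)"
    by (auto intro!: T.finsum_closed pure_tensor_closed cvs_algebra families_upd D_closed
        intro: families_nth)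
  fix k assume k: "k \<in> I"
  show "lin_map A (tpow A I)
      (\<lambda>x. \<Oplus>\<^bsub>tpow A I\<^esub>i\<in>I. pure_tensor A I ((a(k := x))(i := D ((a(k := x)) i))))"
  proof (rule lin_map_finsum_map[OF cvs_algebra T.module_axioms])
    fix i assume i: "i \<in> I"
    show "lin_map A (tpow A I) (\<lambda>x. pure_tensor A I ((a(k := x))(i := D ((a(k := x)) i))))"
    proof (cases "i = k")
      case True
      then show ?thesis using lin_map_compose[OF D_lin lin_map_pure_tensor[OF cvs_algebra a k]] by simp
    next
      case False
      have "a(i := D (a i)) \<in> families A I"
        using a i by (intro families_upd D_closed families_nth)
      from lin_map_pure_tensor[OF cvs_algebra this k] show ?thesis
        using False by (simp add: fun_upd_twist)
    qed
  qed
qed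

end

lemma LG_map_hom:
  assumes "\<phi> \<in> {0..m} \<rightarrow> {0..n}"
  shows "LG_map A m n \<phi> \<in> vhom (LG A m) (LG A n)"
    and "a \<in> families A {0..m} \<Longrightarrow> LG_map A m n \<phi> (pure_tensor A {0..m} a) =
      pure_tensor A {0..n} (fibre_prod A {0..m} {0..n} \<phi> a)"
  using tpow_lin_ext[OF cvs_algebra cvs_tpow[OF cvs_algebra] fibre_prod_multilinear[OF _ assms]]
  by (auto simp: LG_map_def LG_def fibre_prod_def)

lemma LG_der_hom:
  assumes "is_derivation A D"
  shows "LG_der A D n \<in> vhom (LG A n) (LG A n)"
    and "a \<in> families A {0..n} \<Longrightarrow> LG_der A D n (pure_tensor A {0..n} a) =
      (\<Oplus>\<^bsub>LG A n\<^esub>i\<in>{0..n}. pure_tensor A {0..n} (a(i := D (a i))))"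
  using tpow_lin_ext[OF cvs_algebra cvs_tpow[OF cvs_algebra] leibniz_multilinear[OF assms]]
  by (auto simp: LG_der_def LG_def)

lemma cvs_LG: "cvs (LG A n)"
  unfolding LG_def by (rule cvs_tpow[OF cvs_algebra])

text \<open>\<open>L\<^sub>D\<close> is a natural transformation on \<open>\<Gamma>\<close>. On a pure tensor, applying
  \<open>D\<close> to the \<open>j\<close>-th factor of \<open>b = \<phi>(a)\<close> expands by the Leibniz rule into one term for each \<open>i\<close> in the
  fibre over \<open>j\<close>, and the fibres partition the indices of \<open>a\<close>. Empty fibres contribute \<open>D 1 = 0\<close>.\<close>

lemma LG_der_natural:
  assumes D: "is_derivation A D" and \<phi>: "\<phi> \<in> {0..m} \<rightarrow> {0..n}" and x: "x \<in> carrier (LG A m)"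
  shows "LG_der A D n (LG_map A m n \<phi> x) = LG_map A m n \<phi> (LG_der A D m x)"
proof -
  interpret T: module complex_field "LG A n" by (rule cvs_LG)
  let ?p = "fibre_prod A {0..m} {0..n} \<phi>"
  note lins = vhomD(2)[OF LG_map_hom(1)[OF \<phi>]] vhomD(2)[OF LG_der_hom(1)[OF D]]
  note Dc = D_closed[OF D]
  have "LG_der A D n (LG_map A m n \<phi> (pure_tensor A {0..m} a)) =
      LG_map A m n \<phi> (LG_der A D m (pure_tensor A {0..m} a))" if a: "a \<in> families A {0..m}" for a
  proof -
    define g where "g i = pure_tensor A {0..n} (?p (a(i := D (a i))))" for i
    have upd: "a(i := D (a i)) \<in> families A {0..m}" if "i \<in> {0..m}" for i
      using a that by (intro families_upd Dc families_nth)
    have g: "g i \<in> carrier (LG A n)" if "i \<in> {0..m}" for i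
      unfolding g_def LG_def
      by (intro pure_tensor_closed cvs_algebra fibre_prod_closed upd that)
    have fib: "pure_tensor A {0..n} ((?p a)(j := D (?p a j))) = (\<Oplus>\<^bsub>LG A n\<^esub>i\<in>{i \<in> {0..m}. \<phi> i = j}. g i)"
      if j: "j \<in> {0..n}" for j
    proof -
      let ?F = "{i \<in> {0..m}. \<phi> i = j}"
      have lin: "lin_map A (LG A n) (\<lambda>x. pure_tensor A {0..n} ((?p a)(j := x)))"
        unfolding LG_def by (rule lin_map_pure_tensor[OF cvs_algebra fibre_prod_closed[OF a] j])
      have fp: "(\<lambda>i. finprod A (a(i := D (a i))) ?F) \<in> ?F \<rightarrow> carrier A"
        using families_nth[OF upd] by (intro Pi_I A.finprod_closed) auto
      have "D (?p a j) = (\<Oplus>\<^bsub>A\<^esub>i\<in>?F. finprod A (a(i := D (a i))) ?F)"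
        using j a by (simp add: fibre_prod_def) (subst D_finprod[OF D], auto simp: families_def)
      then have "pure_tensor A {0..n} ((?p a)(j := D (?p a j))) =
          (\<Oplus>\<^bsub>LG A n\<^esub>i\<in>?F. pure_tensor A {0..n} ((?p a)(j := finprod A (a(i := D (a i))) ?F)))"
        using lin_map_finsum[OF cvs_algebra cvs_LG lin fp] by (simp only:)
      also have "\<dots> = (\<Oplus>\<^bsub>LG A n\<^esub>i\<in>?F. g i)"
      proof (rule T.finsum_cong')
        fix i assume "i \<in> ?F"
        then show "pure_tensor A {0..n} ((?p a)(j := finprod A (a(i := D (a i))) ?F)) = g i"
          using a j by (auto simp: g_def fibre_prod_upd Dc families_nth)
      qed (use g in auto)
      finally show ?thesis .
    qed
    have "LG_der A D n (LG_map A m n \<phi> (pure_tensor A {0..m} a)) =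
        (\<Oplus>\<^bsub>LG A n\<^esub>j\<in>{0..n}. pure_tensor A {0..n} ((?p a)(j := D (?p a j))))"
      using a by (simp add: LG_map_hom(2)[OF \<phi>] LG_der_hom(2)[OF D] fibre_prod_closed)
    also have "\<dots> = (\<Oplus>\<^bsub>LG A n\<^esub>j\<in>{0..n}. \<Oplus>\<^bsub>LG A n\<^esub>i\<in>{i \<in> {0..m}. \<phi> i = j}. g i)"
      by (rule T.finsum_cong') (use fib g in \<open>auto intro!: T.finsum_closed\<close>)
    also have "\<dots> = (\<Oplus>\<^bsub>LG A n\<^esub>i\<in>(\<Union>j\<in>{0..n}. {i \<in> {0..m}. \<phi> i = j}). g i)"
      by (rule T.add.finprod_UN_disjoint[symmetric]) (use g in \<open>auto simp: pairwise_def disjnt_def\<close>)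
    also have "(\<Union>j\<in>{0..n}. {i \<in> {0..m}. \<phi> i = j}) = {0..m}" using \<phi> by auto
    also have "(\<Oplus>\<^bsub>LG A n\<^esub>i\<in>{0..m}. g i) =
        (\<Oplus>\<^bsub>LG A n\<^esub>i\<in>{0..m}. LG_map A m n \<phi> (pure_tensor A {0..m} (a(i := D (a i)))))"
      by (rule T.finsum_cong')
        (use lin_map_closed[OF lins(1)] upd in \<open>auto simp: g_def LG_map_hom(2)[OF \<phi>] LG_def
          intro!: pure_tensor_closed cvs_algebra fibre_prod_closed\<close>)
    also have "\<dots> = LG_map A m n \<phi> (\<Oplus>\<^bsub>LG A m\<^esub>i\<in>{0..m}. pure_tensor A {0..m} (a(i := D (a i))))"
      by (rule lin_map_finsum[OF cvs_LG cvs_LG lins(1), symmetric])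
        (use upd in \<open>auto simp: LG_def intro!: pure_tensor_closed cvs_algebra\<close>)
    also have "\<dots> = LG_map A m n \<phi> (LG_der A D m (pure_tensor A {0..m} a))"
      using a by (simp add: LG_der_hom(2)[OF D])
    finally show ?thesis .
  qed
  then show ?thesis
    by (rule tpow_eqI[where A = A and I = "{0..m}" and W = "LG A n" and x = x
          and g = "\<lambda>x. LG_der A D n (LG_map A m n \<phi> x)"
          and h = "\<lambda>x. LG_map A m n \<phi> (LG_der A D m x)", folded LG_def,
          OF cvs_algebra cvs_LG lin_map_compose[OF lins(1) vhomD(2)[OF LG_der_hom(1)[OF D]]]
          lin_map_compose[OF lins(2) lins(1)] _ x])
qed

end

section \<open>The extension to finite pointed sets\<close>

lemma slice_iff: "(m, \<phi>) \<in> slice T \<longleftrightarrow> \<phi> \<in> {0..m} \<rightarrow>\<^sub>E fst T \<and> \<phi> 0 = snd T"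
  by (auto simp: slice_def pmaps_def Gobj_def)

lemma pmaps_Gobj: "\<psi> \<in> pmaps (Gobj m) (Gobj m') \<longleftrightarrow> \<psi> \<in> {0..m} \<rightarrow>\<^sub>E {0..m'} \<and> \<psi> 0 = 0"
  by (auto simp: pmaps_def Gobj_def)

lemma slice_precompose:
  "(m', \<phi>) \<in> slice T \<Longrightarrow> \<psi> \<in> pmaps (Gobj m) (Gobj m') \<Longrightarrow> (m, compose {0..m} \<phi> \<psi>) \<in> slice T"
  by (auto simp: slice_iff pmaps_Gobj PiE_iff compose_def extensional_def)

lemma slice_postcompose:
  "(m, \<phi>) \<in> slice T \<Longrightarrow> f \<in> pmaps T T' \<Longrightarrow> (m, compose {0..m} f \<phi>) \<in> slice T'"
  by (auto simp: slice_iff pmaps_def PiE_iff compose_def extensional_def)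

lemma colim_sum_alt: "colim_sum A T = dsum_vs (slice T) (\<lambda>p. LG A (fst p))"
  "colim_sum_in A T = dsum_in (slice T) (\<lambda>p. LG A (fst p))"
  by (simp_all add: colim_sum_def colim_sum_in_def case_prod_unfold)

text \<open>The identifications along morphisms of the slice category; their span is the kernel of the
  map from the direct sum onto the colimit.\<close>

definition colim_rel :: "(complex, 'a) module \<Rightarrow> 't pset \<Rightarrow> ('t, 'a) lsum set" where
  "colim_rel A T = {colim_sum_in A T (m, compose {0..m} \<phi>' \<psi>) x \<ominus>\<^bsub>colim_sum A T\<^esub>
        colim_sum_in A T (m', \<phi>') (LG_map A m m' \<psi> x) | m m' \<phi>' \<psi> x.
      (m', \<phi>') \<in> slice T \<and> \<psi> \<in> pmaps (Gobj m) (Gobj m') \<and> x \<in> carrier (LG A m)}"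

lemma colim_kernel_alt: "colim_kernel A T = vspan (colim_sum A T) (colim_rel A T)"
  by (simp add: colim_kernel_def colim_rel_def)

context
  fixes A :: "(complex, 'a) module"
  assumes alg: "algebra complex_field A"
begin

lemma LG_map_closed:
  assumes "\<psi> \<in> pmaps (Gobj m) (Gobj m')" "x \<in> carrier (LG A m)"
  shows "LG_map A m m' \<psi> x \<in> carrier (LG A m')"
proof -
  have "\<psi> \<in> {0..m} \<rightarrow> {0..m'}" using assms(1) by (auto simp: pmaps_Gobj)
  from lin_map_closed[OF vhomD(2)[OF LG_map_hom(1)[OF alg this]] assms(2)] show ?thesis .
qed

lemma cvs_colim_sum: "cvs (colim_sum A T)"
  unfolding colim_sum_alt by (rule cvs_dsum_vs) (rule cvs_LG[OF alg])

lemma colim_sum_in_lin: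
  assumes "p \<in> slice T"
  shows "lin_map (LG A (fst p)) (colim_sum A T) (colim_sum_in A T p)"
  unfolding colim_sum_alt
  by (rule lin_map_dsum_in[where V = "\<lambda>p. LG A (fst p)"]) (rule cvs_LG[OF alg], rule assms)

lemma colim_sum_in_closed:
  assumes "(m, \<phi>) \<in> slice T" "x \<in> carrier (LG A m)"
  shows "colim_sum_in A T (m, \<phi>) x \<in> carrier (colim_sum A T)"
  using lin_map_closed[OF colim_sum_in_lin[OF assms(1)]] assms(2) by simp

lemma colim_rel_closed: "colim_rel A T \<subseteq> carrier (colim_sum A T)"
proof -
  interpret S: module complex_field "colim_sum A T" by (rule cvs_colim_sum)
  show ?thesis
    by (auto simp: colim_rel_def intro!: S.minus_closed colim_sum_in_closed slice_precompose
        LG_map_closed)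
qed

lemma cvs_quot_colim: "cvs_quot (colim_sum A T) (colim_kernel A T)"
  unfolding colim_kernel_alt
  by (intro cvs_quot.intro cvs_quot_axioms.intro submodule_vspan cvs_colim_sum colim_rel_closed)

lemma cvs_LF: "cvs (LF A T)"
  unfolding LF_def by (rule cvs_quot.cvs_quot[OF cvs_quot_colim])

lemma colim_in_lin:
  assumes "p \<in> slice T"
  shows "lin_map (LG A (fst p)) (LF A T) (colim_in A T p)"
  unfolding LF_def colim_in_def
  by (rule lin_map_compose[OF colim_sum_in_lin[OF assms] cvs_quot.lin_map_coset[OF cvs_quot_colim]])

lemma colim_in_closed:
  assumes "(m, \<phi>) \<in> slice T" "x \<in> carrier (LG A m)"
  shows "colim_in A T (m, \<phi>) x \<in> carrier (LF A T)"
  using lin_map_closed[OF colim_in_lin[OF assms(1)]] assms(2) by simp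

lemma colim_in_cocone:
  assumes "(m', \<phi>) \<in> slice T" "\<psi> \<in> pmaps (Gobj m) (Gobj m')" "x \<in> carrier (LG A m)"
  shows "colim_in A T (m, compose {0..m} \<phi> \<psi>) x = colim_in A T (m', \<phi>) (LG_map A m m' \<psi> x)"
proof -
  interpret cvs_quot "colim_sum A T" "colim_kernel A T" by (rule cvs_quot_colim)
  have "colim_sum_in A T (m, compose {0..m} \<phi> \<psi>) x \<ominus>\<^bsub>colim_sum A T\<^esub>
      colim_sum_in A T (m', \<phi>) (LG_map A m m' \<psi> x) \<in> colim_rel A T"
    unfolding colim_rel_def using assms by blast
  then show ?thesis
    unfolding colim_in_def using vspan_superset[of "colim_rel A T" "colim_sum A T"] assms
    by (subst coset_eq_iff)
      (auto simp: colim_kernel_alt intro!: colim_sum_in_closed slice_precompose LG_map_closed)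
qed

lemma LF_spanning:
  "carrier (LF A T) \<subseteq> vspan (LF A T)
     ((\<lambda>(p, x). colim_in A T p x) ` (SIGMA p : slice T. carrier (LG A (fst p))))"
proof -
  interpret cvs_quot "colim_sum A T" "colim_kernel A T" by (rule cvs_quot_colim)
  let ?G = "(\<lambda>(p, x). colim_sum_in A T p x) ` (SIGMA p : slice T. carrier (LG A (fst p)))"
  have closed: "?G \<subseteq> carrier (colim_sum A T)" by (auto intro: colim_sum_in_closed)
  have "carrier (colim_sum A T) \<subseteq> vspan (colim_sum A T) ?G"
    unfolding colim_sum_alt(1)
  proof (rule dsum_spanning)
    show "dsum_in (slice T) (\<lambda>p. LG A (fst p)) p x \<in> vspan (dsum_vs (slice T) (\<lambda>p. LG A (fst p))) ?G"
      if "p \<in> slice T" "x \<in> carrier (LG A (fst p))" for p x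
      by (rule subsetD[OF vspan_superset]) (use that in \<open>force simp: colim_sum_alt\<close>)
  qed (use closed cvs_LG[OF alg] in \<open>auto simp: colim_sum_alt(1)\<close>)
  moreover have "carrier (quot_vs (colim_sum A T) (colim_kernel A T)) \<subseteq>
      (\<lambda>x. colim_kernel A T +>\<^bsub>colim_sum A T\<^esub> x) ` carrier (colim_sum A T)"
    by (auto elim!: quot_carrierE)
  ultimately have "carrier (LF A T) \<subseteq> vspan (LF A T) ((\<lambda>x. colim_kernel A T +>\<^bsub>colim_sum A T\<^esub> x) ` ?G)"
    unfolding LF_def by (intro spanning_image[OF cvs_colim_sum cvs_quot lin_map_coset] closed)
  then show ?thesis by (simp add: image_image case_prod_unfold colim_in_def)
qed

lemma LF_eqI:
  assumes "cvs W" "lin_map (LF A T) W g" "lin_map (LF A T) W h"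
    and "\<And>m \<phi> y. (m, \<phi>) \<in> slice T \<Longrightarrow> y \<in> carrier (LG A m) \<Longrightarrow>
      g (colim_in A T (m, \<phi>) y) = h (colim_in A T (m, \<phi>) y)"
    and "x \<in> carrier (LF A T)"
  shows "g x = h x"
  by (rule spanning_eq[OF cvs_LF assms(1-3) LF_spanning])
    (auto simp: assms(4,5) intro!: colim_in_closed)

text \<open>The universal property of the colimit: a cocone \<open>h\<close> of linear maps over the slice category
  induces the linear map defined by \<open>lin_ext\<close>.\<close>

lemma LF_lin_ext:
  assumes W: "cvs W" and h: "\<And>m \<phi>. (m, \<phi>) \<in> slice T \<Longrightarrow> lin_map (LG A m) W (h m \<phi>)"
    and compat: "\<And>m m' \<phi> \<psi> x. (m', \<phi>) \<in> slice T \<Longrightarrow> \<psi> \<in> pmaps (Gobj m) (Gobj m') \<Longrightarrow>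
      x \<in> carrier (LG A m) \<Longrightarrow> h m (compose {0..m} \<phi> \<psi>) x = h m' \<phi> (LG_map A m m' \<psi> x)"
  defines "k \<equiv> lin_ext (LF A T) W (SIGMA p : slice T. carrier (LG A (fst p)))
     (\<lambda>(p, x). colim_in A T p x) (\<lambda>((m, \<phi>), x). h m \<phi> x)"
  shows "k \<in> vhom (LF A T) W"
    and "\<And>m \<phi> x. (m, \<phi>) \<in> slice T \<Longrightarrow> x \<in> carrier (LG A m) \<Longrightarrow> k (colim_in A T (m, \<phi>) x) = h m \<phi> x"
proof -
  interpret W: module complex_field W by (rule W)
  have h': "lin_map (LG A (fst p)) W (h (fst p) (snd p))" if "p \<in> slice T" for p
    using h[of "fst p" "snd p"] that by simp
  obtain g where g: "lin_map (colim_sum A T) W g"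
    and gi: "\<And>m \<phi> x. (m, \<phi>) \<in> slice T \<Longrightarrow> x \<in> carrier (LG A m) \<Longrightarrow>
      g (colim_sum_in A T (m, \<phi>) x) = h m \<phi> x"
    using dsum_lift[of "slice T" "\<lambda>p. LG A (fst p)" W "\<lambda>p. h (fst p) (snd p)", OF cvs_LG[OF alg] W h']
    unfolding colim_sum_alt by (metis fst_conv snd_conv)
  have self: "x \<ominus>\<^bsub>W\<^esub> x = \<zero>\<^bsub>W\<^esub>" if "x \<in> carrier W" for x
    using that by (simp add: a_minus_def W.r_neg)
  have "g y = \<zero>\<^bsub>W\<^esub>" if "y \<in> colim_rel A T" for y
    using that unfolding colim_rel_def
    by (auto simp: lin_map_minus[OF cvs_colim_sum W g] colim_sum_in_closed slice_precompose
        LG_map_closed gi compat lin_map_closed[OF h] self)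
  from vspan_quot_lift[OF cvs_colim_sum W colim_rel_closed g this]
  obtain f where f: "lin_map (LF A T) W f"
    and fi: "\<And>x. x \<in> carrier (colim_sum A T) \<Longrightarrow>
      f (colim_kernel A T +>\<^bsub>colim_sum A T\<^esub> x) = g x"
    unfolding LF_def colim_kernel_alt by blast
  have "f ((\<lambda>(p, x). colim_in A T p x) s) = (\<lambda>((m, \<phi>), x). h m \<phi> x) s"
    if "s \<in> (SIGMA p : slice T. carrier (LG A (fst p)))" for s
    using that by (auto simp: colim_in_def fi gi colim_sum_in_closed)
  moreover have "(\<lambda>(p, x). colim_in A T p x) ` (SIGMA p : slice T. carrier (LG A (fst p)))
      \<subseteq> carrier (LF A T)"
    by (auto intro: colim_in_closed)
  ultimately have *: "k \<in> vhom (LF A T) W"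
    "\<And>s. s \<in> (SIGMA p : slice T. carrier (LG A (fst p))) \<Longrightarrow>
      k ((\<lambda>(p, x). colim_in A T p x) s) = (\<lambda>((m, \<phi>), x). h m \<phi> x) s"
    unfolding k_def using lin_ext_spec[OF cvs_LF W LF_spanning _ f] by blast+
  show "k \<in> vhom (LF A T) W" by (rule *(1))
  show "k (colim_in A T (m, \<phi>) x) = h m \<phi> x" if "(m, \<phi>) \<in> slice T" "x \<in> carrier (LG A m)" for m \<phi> x
    using *(2)[of "((m, \<phi>), x)"] that by simp
qed

lemma LF_map_hom:
  assumes f: "f \<in> pmaps T T'"
  shows "LF_map A T T' f \<in> vhom (LF A T) (LF A T')"
    and "\<And>m \<phi> x. (m, \<phi>) \<in> slice T \<Longrightarrow> x \<in> carrier (LG A m) \<Longrightarrow>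
      LF_map A T T' f (colim_in A T (m, \<phi>) x) = colim_in A T' (m, compose {0..m} f \<phi>) x"
proof -
  have "lin_map (LG A m) (LF A T') (colim_in A T' (m, compose {0..m} f \<phi>))"
    if "(m, \<phi>) \<in> slice T" for m \<phi>
    using colim_in_lin[OF slice_postcompose[OF that f]] by simp
  moreover have "colim_in A T' (m, compose {0..m} f (compose {0..m} \<phi> \<psi>)) x =
      colim_in A T' (m', compose {0..m'} f \<phi>) (LG_map A m m' \<psi> x)"
    if "(m', \<phi>) \<in> slice T" "\<psi> \<in> pmaps (Gobj m) (Gobj m')" "x \<in> carrier (LG A m)" for m m' \<phi> \<psi> x
  proof -
    have "compose {0..m} f (compose {0..m} \<phi> \<psi>) = compose {0..m} (compose {0..m'} f \<phi>) \<psi>"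
      using that(2) by (auto simp: compose_def fun_eq_iff pmaps_Gobj PiE_iff)
    then show ?thesis
      using colim_in_cocone[OF slice_postcompose[OF that(1) f] that(2,3)] by simp
  qed
  ultimately show "LF_map A T T' f \<in> vhom (LF A T) (LF A T')"
    and "\<And>m \<phi> x. (m, \<phi>) \<in> slice T \<Longrightarrow> x \<in> carrier (LG A m) \<Longrightarrow>
      LF_map A T T' f (colim_in A T (m, \<phi>) x) = colim_in A T' (m, compose {0..m} f \<phi>) x"
    unfolding LF_map_def
    using LF_lin_ext[of "LF A T'" T "\<lambda>m \<phi>. colim_in A T' (m, compose {0..m} f \<phi>)", OF cvs_LF]
    by blast+
qed

lemma LF_der_hom:
  assumes D: "is_derivation A D"
  shows "LF_der A D T \<in> vhom (LF A T) (LF A T)"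
    and "\<And>m \<phi> x. (m, \<phi>) \<in> slice T \<Longrightarrow> x \<in> carrier (LG A m) \<Longrightarrow>
      LF_der A D T (colim_in A T (m, \<phi>) x) = colim_in A T (m, \<phi>) (LG_der A D m x)"
proof -
  have "lin_map (LG A m) (LF A T) (\<lambda>x. colim_in A T (m, \<phi>) (LG_der A D m x))"
    if "(m, \<phi>) \<in> slice T" for m \<phi>
    using lin_map_compose[OF vhomD(2)[OF LG_der_hom(1)[OF alg D]]] colim_in_lin[OF that] by simp
  moreover have "colim_in A T (m, compose {0..m} \<phi> \<psi>) (LG_der A D m x) =
      colim_in A T (m', \<phi>) (LG_der A D m' (LG_map A m m' \<psi> x))"
    if "(m', \<phi>) \<in> slice T" "\<psi> \<in> pmaps (Gobj m) (Gobj m')" "x \<in> carrier (LG A m)" for m m' \<phi> \<psi> x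
  proof -
    have "LG_der A D m x \<in> carrier (LG A m)"
      using lin_map_closed[OF vhomD(2)[OF LG_der_hom(1)[OF alg D]] that(3)] .
    moreover have "\<psi> \<in> {0..m} \<rightarrow> {0..m'}" using that(2) by (auto simp: pmaps_Gobj)
    ultimately show ?thesis
      using colim_in_cocone[OF that(1,2)] LG_der_natural[OF alg D _ that(3)] by simp
  qed
  ultimately show "LF_der A D T \<in> vhom (LF A T) (LF A T)"
    and "\<And>m \<phi> x. (m, \<phi>) \<in> slice T \<Longrightarrow> x \<in> carrier (LG A m) \<Longrightarrow>
      LF_der A D T (colim_in A T (m, \<phi>) x) = colim_in A T (m, \<phi>) (LG_der A D m x)"
    unfolding LF_der_def
    using LF_lin_ext[of "LF A T" T "\<lambda>m \<phi> x. colim_in A T (m, \<phi>) (LG_der A D m x)", OF cvs_LF]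
    by blast+
qed

text \<open>Both sides agree on the image of the cocone, since \<open>\<L>(A)(f)\<close> only changes the index \<open>\<phi>\<close> to
  \<open>f \<circ> \<phi>\<close>, and \<open>L\<^sub>D\<close> only acts on the element at that index.\<close>

lemma LF_der_natural:
  assumes D: "is_derivation A D" and f: "f \<in> pmaps T T'" and x: "x \<in> carrier (LF A T)"
  shows "LF_der A D T' (LF_map A T T' f x) = LF_map A T T' f (LF_der A D T x)"
proof (rule LF_eqI[where g = "\<lambda>x. LF_der A D T' (LF_map A T T' f x)"
      and h = "\<lambda>x. LF_map A T T' f (LF_der A D T x)", OF cvs_LF _ _ _ x])
  note lins = vhomD(2)[OF LF_map_hom(1)[OF f]] vhomD(2)[OF LF_der_hom(1)[OF D]]
  show "lin_map (LF A T) (LF A T') (\<lambda>x. LF_der A D T' (LF_map A T T' f x))"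
    by (rule lin_map_compose[OF lins(1) lins(2)])
  show "lin_map (LF A T) (LF A T') (\<lambda>x. LF_map A T T' f (LF_der A D T x))"
    by (rule lin_map_compose[OF lins(2) lins(1)])
  fix m \<phi> y assume p: "(m, \<phi>) \<in> slice T" and y: "y \<in> carrier (LG A m)"
  then show "LF_der A D T' (LF_map A T T' f (colim_in A T (m, \<phi>) y)) =
      LF_map A T T' f (LF_der A D T (colim_in A T (m, \<phi>) y))"
    using lin_map_closed[OF vhomD(2)[OF LG_der_hom(1)[OF alg D]] y]
    by (simp add: LF_map_hom(2)[OF f] LF_der_hom(2)[OF D] slice_postcompose[OF _ f])
qed

end

section \<open>Endomorphisms of \<open>N\<close>-complexes and homology\<close>

text \<open>A degree \<open>0\<close> endomorphism \<open>L\<close>, commuting with \<open>d\<close>, of a sequence of vector spaces with maps \<open>d\<close> of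
  degree \<open>-1\<close>. The identity \<open>d\<^sup>N = 0\<close> is not needed: the homology classes below are cosets of
  the boundaries in the whole of \<open>C n\<close>, so they can be added and scaled, and \<open>L\<close> acts on them,
  whether or not the boundaries are cycles.\<close>

locale complex_endo =
  fixes C :: "int \<Rightarrow> (complex, 'v) module" and d L :: "int \<Rightarrow> 'v \<Rightarrow> 'v"
  assumes C: "cvs (C n)"
    and d_lin: "lin_map (C n) (C (n - 1)) (d n)"
    and L_lin: "lin_map (C n) (C n) (L n)"
    and comm: "x \<in> carrier (C n) \<Longrightarrow> L (n - 1) (d n x) = d n (L n x)"
begin

lemma iter_lin: "lin_map (C n) (C (n - int i)) (iter_d d i n)"
proof (induction i)
  case 0
  then show ?case using lin_map_id by (simp add: lin_map_def)
next
  case (Suc i)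
  show ?case using lin_map_compose[OF Suc d_lin] by (simp add: algebra_simps lin_map_def)
qed

lemma iter_comm: "x \<in> carrier (C n) \<Longrightarrow> L (n - int i) (iter_d d i n x) = iter_d d i n (L n x)"
proof (induction i)
  case (Suc i)
  then show ?case using comm[OF lin_map_closed[OF iter_lin Suc.prems], of i] by (simp add: algebra_simps)
qed simp

lemma submodule_cycles: "submodule (cycles C d i n) complex_field (C n)"
  unfolding cycles_def by (rule submodule_equalizer[OF C C iter_lin lin_map_zero_map[OF C]])

lemma submodule_boundaries: "submodule (boundaries N C d i n) complex_field (C n)"
proof -
  interpret M: module complex_field "C (n + int (N - i))" by (rule C)
  show ?thesis
    unfolding boundaries_def
    using submodule_image[OF C C iter_lin[of "n + int (N - i)" "N - i"] M.carrier_is_submodule] by simp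
qed

lemma cycles_subset: "L n ` cycles C d i n \<subseteq> cycles C d i n"
  using lin_map_closed[OF L_lin] iter_comm[symmetric, of _ n i] lin_map_zero[OF C C L_lin]
  by (auto simp: cycles_def)

lemma boundaries_subset: "L n ` boundaries N C d i n \<subseteq> boundaries N C d i n"
  using iter_comm[of _ "n + int (N - i)" "N - i"] lin_map_closed[OF L_lin]
  by (auto simp: boundaries_def)

lemma cvs_quot_boundaries: "cvs_quot (C n) (boundaries N C d i n)"
  by (intro cvs_quot.intro cvs_quot_axioms.intro C submodule_boundaries)

lemma cycles_closed: "x \<in> cycles C d i n \<Longrightarrow> x \<in> carrier (C n)"
  by (simp add: cycles_def)

text \<open>The operations of \<open>homology_part\<close> on classes of cycles are those of cosets in \<open>C n\<close>:
  restricting the carrier to the cycles does not alter cosets or their sums.\<close>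

lemma homology_part_ops:
  "carrier (homology_part N C d i n) = homology_class N C d i n ` cycles C d i n"
  "x \<in> cycles C d i n \<Longrightarrow> y \<in> cycles C d i n \<Longrightarrow>
    homology_class N C d i n x \<oplus>\<^bsub>homology_part N C d i n\<^esub> homology_class N C d i n y =
    homology_class N C d i n (x \<oplus>\<^bsub>C n\<^esub> y)"
  "x \<in> cycles C d i n \<Longrightarrow>
    c \<odot>\<^bsub>homology_part N C d i n\<^esub> homology_class N C d i n x = homology_class N C d i n (c \<odot>\<^bsub>C n\<^esub> x)"
proof -
  interpret cvs_quot "C n" "boundaries N C d i n" by (rule cvs_quot_boundaries)
  note ops = quot_ops[of "C n\<lparr>carrier := cycles C d i n\<rparr>" "boundaries N C d i n"]
  have same: "a_r_coset (C n\<lparr>carrier := cycles C d i n\<rparr>) = a_r_coset (C n)"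
    "set_add (C n\<lparr>carrier := cycles C d i n\<rparr>) = set_add (C n)"
    by (simp_all add: fun_eq_iff a_r_coset_def' set_add_def')
  show "carrier (homology_part N C d i n) = homology_class N C d i n ` cycles C d i n"
    using ops(1) by (auto simp: homology_part_def homology_class_def same)
  show "homology_class N C d i n x \<oplus>\<^bsub>homology_part N C d i n\<^esub> homology_class N C d i n y =
      homology_class N C d i n (x \<oplus>\<^bsub>C n\<^esub> y)" if "x \<in> cycles C d i n" "y \<in> cycles C d i n"
    using that cycles_closed ops(3)
    by (simp add: homology_part_def homology_class_def same coset_add)
  show "c \<odot>\<^bsub>homology_part N C d i n\<^esub> homology_class N C d i n x = homology_class N C d i n (c \<odot>\<^bsub>C n\<^esub> x)"
    if "x \<in> cycles C d i n"
    using that cycles_closed ops(4)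
    by (simp add: homology_part_def homology_class_def same coset_smult)
qed

lemma homology_class_L:
  assumes "x \<in> carrier (C n)" "y \<in> carrier (C n)"
    and "homology_class N C d i n x = homology_class N C d i n y"
  shows "homology_class N C d i n (L n x) = homology_class N C d i n (L n y)"
proof -
  interpret cvs_quot "C n" "boundaries N C d i n" by (rule cvs_quot_boundaries)
  have "x \<ominus>\<^bsub>C n\<^esub> y \<in> boundaries N C d i n"
    using assms by (simp add: homology_class_def coset_eq_iff)
  then have "L n x \<ominus>\<^bsub>C n\<^esub> L n y \<in> boundaries N C d i n"
    using boundaries_subset lin_map_minus[OF C C L_lin assms(1,2)] by (metis image_subset_iff)
  then show ?thesis
    using assms lin_map_closed[OF L_lin] by (simp add: homology_class_def coset_eq_iff)
qed

text \<open>As \<open>{1..<N}\<close> is finite, the direct sum of the \<open>homology_part\<close>s is their product, and every element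
  is the tuple of classes of some family of cycles.\<close>

lemma homology_carrier:
  "carrier (homology N C d n) =
    (\<lambda>z. \<lambda>i\<in>{1..<N}. homology_class N C d i n (z i)) ` (\<Pi>\<^sub>E i\<in>{1..<N}. cycles C d i n)"
  (is "_ = ?c ` ?Z")
proof (intro equalityI subsetI)
  fix K assume "K \<in> carrier (homology N C d n)"
  then have K: "K \<in> (\<Pi>\<^sub>E i\<in>{1..<N}. homology_class N C d i n ` cycles C d i n)"
    by (simp add: homology_def dsum_carrier homology_part_ops)
  define z where "z = (\<lambda>i\<in>{1..<N}. SOME x. x \<in> cycles C d i n \<and> K i = homology_class N C d i n x)"
  have z: "z i \<in> cycles C d i n \<and> K i = homology_class N C d i n (z i)" if "i \<in> {1..<N}" for i
  proof -
    have "\<exists>x. x \<in> cycles C d i n \<and> K i = homology_class N C d i n x" using K that by (auto dest: PiE_mem)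
    from someI_ex[OF this] show ?thesis using that by (simp add: z_def)
  qed
  then have "z \<in> ?Z" by (auto simp: z_def)
  moreover have "K = ?c z"
    by (rule extensionalityI[of _ "{1..<N}"]) (use K z in \<open>auto simp: PiE_iff\<close>)
  ultimately show "K \<in> ?c ` ?Z" by blast
next
  fix K assume "K \<in> ?c ` ?Z"
  then show "K \<in> carrier (homology N C d n)"
    by (auto simp: homology_def dsum_carrier homology_part_ops PiE_iff)
qed

lemma induced_map_on_homology:
  "\<exists>!F. F \<in> vhom (homology N C d n) (homology N C d n) \<and>
     (\<forall>z \<in> (\<Pi>\<^sub>E i\<in>{1..<N}. cycles C d i n).
        F (\<lambda>i\<in>{1..<N}. homology_class N C d i n (z i)) =
        (\<lambda>i\<in>{1..<N}. homology_class N C d i n (L n (z i))))"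
proof -
  let ?H = "homology N C d n" and ?Z = "\<Pi>\<^sub>E i\<in>{1..<N}. cycles C d i n"
  define cls where "cls z = (\<lambda>i\<in>{1..<N}. homology_class N C d i n (z i))" for z
  define Lz where "Lz z = (\<lambda>i\<in>{1..<N}. L n (z i))" for z
  \<comment> \<open>\<open>F\<close> applies \<open>L\<close> to some choice of representing cycles; the fact \<open>F\<close> below says that the choice is
    immaterial.\<close>
  define F where "F = (\<lambda>K\<in>carrier ?H. cls (Lz (SOME z. z \<in> ?Z \<and> K = cls z)))"
  have car: "carrier ?H = cls ` ?Z"
    unfolding homology_carrier cls_def ..
  have Lz: "Lz z \<in> ?Z" if "z \<in> ?Z" for z
    using that by (auto simp: Lz_def PiE_iff intro: subsetD[OF cycles_subset imageI])
  have F: "F (cls z) = cls (Lz z)" if z: "z \<in> ?Z" for z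
  proof -
    define y where "y = (SOME y. y \<in> ?Z \<and> cls z = cls y)"
    have y: "y \<in> ?Z" "cls z = cls y"
      using someI_ex[of "\<lambda>y. y \<in> ?Z \<and> cls z = cls y"] z by (auto simp: y_def)
    have "homology_class N C d i n (L n (y i)) = homology_class N C d i n (L n (z i))"
      if "i \<in> {1..<N}" for i
    proof (rule homology_class_L)
      show "y i \<in> carrier (C n)" "z i \<in> carrier (C n)"
        using y(1) z that by (auto simp: PiE_iff intro: cycles_closed)
      show "homology_class N C d i n (y i) = homology_class N C d i n (z i)"
        using fun_cong[OF y(2), of i] that by (simp add: cls_def)
    qed
    then have "cls (Lz y) = cls (Lz z)" by (auto simp: cls_def Lz_def intro!: restrict_ext)
    moreover have "cls z \<in> carrier ?H" using z car by blast
    then have "F (cls z) = cls (Lz y)" unfolding F_def y_def by (rule restrict_apply')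
    ultimately show ?thesis by simp
  qed
  have add: "cls z \<oplus>\<^bsub>?H\<^esub> cls z' = cls (\<lambda>i\<in>{1..<N}. z i \<oplus>\<^bsub>C n\<^esub> z' i)"
    if "z \<in> ?Z" "z' \<in> ?Z" for z z'
    using that
    by (auto simp: homology_def cls_def homology_part_ops PiE_iff intro!: restrict_ext)
  have smult: "c \<odot>\<^bsub>?H\<^esub> cls z = cls (\<lambda>i\<in>{1..<N}. c \<odot>\<^bsub>C n\<^esub> z i)" if "z \<in> ?Z" for z c
    using that
    by (auto simp: homology_def cls_def homology_part_ops PiE_iff intro!: restrict_ext)
  have addZ: "(\<lambda>i\<in>{1..<N}. z i \<oplus>\<^bsub>C n\<^esub> z' i) \<in> ?Z" if "z \<in> ?Z" "z' \<in> ?Z" for z z'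
    using that module.submoduleE(5)[OF C submodule_cycles] by (auto simp: PiE_iff)
  have smultZ: "(\<lambda>i\<in>{1..<N}. c \<odot>\<^bsub>C n\<^esub> z i) \<in> ?Z" if "z \<in> ?Z" for z c
    using that module.submoduleE(4)[OF C submodule_cycles] by (auto simp: PiE_iff)
  have cl: "z i \<in> carrier (C n)" if "z \<in> ?Z" "i \<in> {1..<N}" for z i
    using that by (auto simp: PiE_iff intro: cycles_closed)
  have "lin_map ?H ?H F"
  proof (rule lin_mapI)
    fix K K' assume "K \<in> carrier ?H" "K' \<in> carrier ?H"
    then obtain z z' where z: "z \<in> ?Z" "K = cls z" and z': "z' \<in> ?Z" "K' = cls z'"
      using car by auto
    show "F K \<in> carrier ?H" using F[OF z(1)] Lz[OF z(1)] z car by auto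
    have "Lz (\<lambda>i\<in>{1..<N}. z i \<oplus>\<^bsub>C n\<^esub> z' i) = (\<lambda>i\<in>{1..<N}. Lz z i \<oplus>\<^bsub>C n\<^esub> Lz z' i)"
      using cl[OF z(1)] cl[OF z'(1)] by (auto simp: Lz_def lin_map_add[OF L_lin] intro!: restrict_ext)
    then show "F (K \<oplus>\<^bsub>?H\<^esub> K') = F K \<oplus>\<^bsub>?H\<^esub> F K'"
      using z z' Lz by (simp only: add F addZ)
  next
    fix c K assume "K \<in> carrier ?H"
    then obtain z where z: "z \<in> ?Z" "K = cls z"
      using car by auto
    have "Lz (\<lambda>i\<in>{1..<N}. c \<odot>\<^bsub>C n\<^esub> z i) = (\<lambda>i\<in>{1..<N}. c \<odot>\<^bsub>C n\<^esub> Lz z i)"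
      using cl[OF z(1)] by (auto simp: Lz_def lin_map_smult[OF L_lin] intro!: restrict_ext)
    then show "F (c \<odot>\<^bsub>?H\<^esub> K) = c \<odot>\<^bsub>?H\<^esub> F K"
      using z Lz by (simp only: smult F smultZ)
  qed
  then have Fhom: "F \<in> vhom ?H ?H" by (simp add: vhom_def F_def)
  have clsL: "cls (Lz z) = (\<lambda>i\<in>{1..<N}. homology_class N C d i n (L n (z i)))" for z
    by (auto simp: cls_def Lz_def intro!: restrict_ext)
  show ?thesis
  proof (rule ex1I)
    show "F \<in> vhom ?H ?H \<and> (\<forall>z\<in>?Z. F (\<lambda>i\<in>{1..<N}. homology_class N C d i n (z i)) =
        (\<lambda>i\<in>{1..<N}. homology_class N C d i n (L n (z i))))"
      using Fhom F clsL by (simp add: cls_def)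
  next
    fix G assume G: "G \<in> vhom ?H ?H \<and> (\<forall>z\<in>?Z. G (\<lambda>i\<in>{1..<N}. homology_class N C d i n (z i)) =
        (\<lambda>i\<in>{1..<N}. homology_class N C d i n (L n (z i))))"
    show "G = F"
    proof (rule vhom_eqI)
      fix K assume "K \<in> carrier ?H"
      then obtain z where z: "z \<in> ?Z" "K = cls z" using car by auto
      then have "G K = cls (Lz z)" using G clsL by (simp add: cls_def)
      then show "G K = F K" using z F by simp
    qed (use G Fhom in auto)
  qed
qed

end

section \<open>The Hom complex of \<open>\<L>\<^sup>Y(A)\<close>\<close>

lemma coface_simplex_map: "0 < n \<Longrightarrow> i \<le> n \<Longrightarrow> coface n i \<in> simplex_maps (n - 1) n"
  by (auto simp: simplex_maps_def coface_def mono_on_def)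

context
  fixes A :: "(complex, 'a) module" and Y :: "'t simplicial_pset"
  assumes alg: "algebra complex_field A" and Y: "pointed_simplicial_finite_set Y"
begin

lemma cvs_LY: "cvs (LY A Y n)"
  by (simp add: LY_def cvs_zero_vs cvs_LF[OF alg])

lemma act_coface: "0 < n \<Longrightarrow> i \<le> n \<Longrightarrow> act Y (n - 1) n (coface n i) \<in> pmaps (ob Y n) (ob Y (n - 1))"
  using Y coface_simplex_map by (auto simp: pointed_simplicial_finite_set_def)

lemma LY_face_lin:
  assumes "0 < n" "i \<le> nat n"
  shows "lin_map (LY A Y n) (LY A Y (n - 1)) (LY_face A Y (nat n) i)"
proof -
  have "nat (n - 1) = nat n - 1" using assms by simp
  then show ?thesis
    using vhomD(2)[OF LF_map_hom(1)[OF alg act_coface[of "nat n" i]]] assms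
    by (simp add: LY_def LY_face_def)
qed

lemma LY_b_lin: "lin_map (LY A Y n) (LY A Y (n - 1)) (LY_b A Y q n)"
proof (cases "n \<le> 0")
  case True
  then show ?thesis
    using lin_map_zero_map[OF cvs_LY[of "n - 1"], of "LY A Y n"]
    by (subst lin_map_cong[OF cvs_LY]) (auto simp: LY_b_def)
next
  case False
  have "lin_map (LY A Y n) (LY A Y (n - 1))
      (\<lambda>x. \<Oplus>\<^bsub>LY A Y (n - 1)\<^esub>i\<in>{0..nat n}. q ^ i \<odot>\<^bsub>LY A Y (n - 1)\<^esub> LY_face A Y (nat n) i x)"
    by (intro lin_map_finsum_map lin_map_smult_map cvs_LY LY_face_lin) (use False in auto)
  then show ?thesis
    using False by (subst lin_map_cong[OF cvs_LY]) (auto simp: LY_b_def)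
qed

context
  fixes D
  assumes D: "is_derivation A D"
begin

lemma LY_der_lin: "lin_map (LY A Y n) (LY A Y n) (LY_der A D Y n)"
proof (cases "n < 0")
  case True
  then show ?thesis
    using lin_map_zero_map[OF cvs_LY[of n], of "LY A Y n"]
    by (subst lin_map_cong[OF cvs_LY]) (auto simp: LY_der_def)
next
  case False
  then show ?thesis
    using vhomD(2)[OF LF_der_hom(1)[OF alg D]] by (simp add: LY_def LY_der_def)
qed

lemma LY_face_der:
  assumes "0 < n" "i \<le> nat n" "x \<in> carrier (LY A Y n)"
  shows "LY_der A D Y (n - 1) (LY_face A Y (nat n) i x) = LY_face A Y (nat n) i (LY_der A D Y n x)"
proof -
  have "nat (n - 1) = nat n - 1" using assms by simp
  then show ?thesis
    using LF_der_natural[OF alg D act_coface[of "nat n" i]] assms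
    by (simp add: LY_def LY_face_def LY_der_def)
qed

text \<open>The differential is a linear combination of faces, each of which commutes with \<open>L\<^sub>D\<close> by
  naturality; in degrees \<open>n \<le> 0\<close> it is zero.\<close>

lemma LY_b_der:
  assumes x: "x \<in> carrier (LY A Y n)"
  shows "LY_der A D Y (n - 1) (LY_b A Y q n x) = LY_b A Y q n (LY_der A D Y n x)"
proof -
  interpret W: module complex_field "LY A Y (n - 1)" by (rule cvs_LY)
  note Lx = lin_map_closed[OF LY_der_lin x]
  show ?thesis
  proof (cases "n \<le> 0")
    case True
    then show ?thesis
      using x Lx lin_map_zero[OF cvs_LY cvs_LY LY_der_lin] by (simp add: LY_b_def)
  next
    case False
    let ?f = "\<lambda>i. q ^ i \<odot>\<^bsub>LY A Y (n - 1)\<^esub> LY_face A Y (nat n) i x"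
    have face: "LY_face A Y (nat n) i y \<in> carrier (LY A Y (n - 1))"
      if "i \<in> {0..nat n}" "y \<in> carrier (LY A Y n)" for i y
      using lin_map_closed[OF LY_face_lin] that False by auto
    have "LY_der A D Y (n - 1) (\<Oplus>\<^bsub>LY A Y (n - 1)\<^esub>i\<in>{0..nat n}. ?f i) =
        (\<Oplus>\<^bsub>LY A Y (n - 1)\<^esub>i\<in>{0..nat n}. LY_der A D Y (n - 1) (?f i))"
      by (rule lin_map_finsum[OF cvs_LY cvs_LY LY_der_lin]) (use x face in auto)
    also have "\<dots> = (\<Oplus>\<^bsub>LY A Y (n - 1)\<^esub>i\<in>{0..nat n}.
        q ^ i \<odot>\<^bsub>LY A Y (n - 1)\<^esub> LY_face A Y (nat n) i (LY_der A D Y n x))"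
      by (rule W.finsum_cong')
        (use False x Lx face in \<open>auto simp: lin_map_smult[OF LY_der_lin] LY_face_der\<close>)
    finally show ?thesis using False x Lx by (simp add: LY_b_def)
  qed
qed

end

lemma HomY_carrier: "f \<in> carrier (HomY A Y n) \<longleftrightarrow> (\<forall>i. f i \<in> vhom (LY A Y i) (LY A Y (i + n)))"
  by (simp add: HomY_def prod_vs_def hom_vs_def PiE_iff)

lemma cvs_HomY: "cvs (HomY A Y n)"
  unfolding HomY_def by (intro cvs_prod_vs cvs_hom_vs cvs_LY)

lemma HomY_ops:
  "f \<oplus>\<^bsub>HomY A Y n\<^esub> g = (\<lambda>i. \<lambda>x\<in>carrier (LY A Y i). f i x \<oplus>\<^bsub>LY A Y (i + n)\<^esub> g i x)"
  "c \<odot>\<^bsub>HomY A Y n\<^esub> f = (\<lambda>i. \<lambda>x\<in>carrier (LY A Y i). c \<odot>\<^bsub>LY A Y (i + n)\<^esub> f i x)"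
  by (auto simp: HomY_def prod_vs_def hom_vs_def fun_eq_iff)

lemma HomY_lin: "f \<in> carrier (HomY A Y n) \<Longrightarrow> lin_map (LY A Y i) (LY A Y (i + n)) (f i)"
  by (auto simp: HomY_carrier dest: vhomD)

lemma HomY_closed:
  "f \<in> carrier (HomY A Y n) \<Longrightarrow> x \<in> carrier (LY A Y i) \<Longrightarrow> f i x \<in> carrier (LY A Y (i + n))"
  using lin_map_closed[OF HomY_lin] by blast

end

context
  fixes A :: "(complex, 'a) module" and Y :: "'t simplicial_pset" and D
  assumes alg: "algebra complex_field A" and Y: "pointed_simplicial_finite_set Y"
    and D: "is_derivation A D"
begin

lemma HomY_d_lin: "lin_map (HomY A Y n) (HomY A Y (n - 1)) (HomY_d A Y q n)"
proof (rule lin_mapI)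
  note LY = cvs_LY[OF alg Y] and hl = HomY_lin[OF alg Y] and hc = HomY_closed[OF alg Y]
  note bl = LY_b_lin[OF alg Y, of _ q]
  note bc = lin_map_closed[OF bl]
  have b1: "LY_b A Y q (i + n) (f i x) \<in> carrier (LY A Y (i + n - 1))"
    if "f \<in> carrier (HomY A Y n)" "x \<in> carrier (LY A Y i)" for f i x
    using bc hc that by blast
  have b2: "f (i - 1) (LY_b A Y q i x) \<in> carrier (LY A Y (i + n - 1))"
    if "f \<in> carrier (HomY A Y n)" "x \<in> carrier (LY A Y i)" for f i x
    using hc[OF that(1) bc[OF that(2)]] by (simp add: diff_add_eq)
  have sc: "c \<odot>\<^bsub>LY A Y i\<^esub> y \<in> carrier (LY A Y i)" if "y \<in> carrier (LY A Y i)" for c i y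
    using module.smult_closed[OF LY] that by simp
  fix f assume f: "f \<in> carrier (HomY A Y n)"
  have "lin_map (LY A Y i) (LY A Y (i + n - 1)) (\<lambda>x. f (i - 1) (LY_b A Y q i x))" for i
    using lin_map_compose[OF bl hl[OF f]] by (simp add: diff_add_eq)
  then show "HomY_d A Y q n f \<in> carrier (HomY A Y (n - 1))"
    unfolding HomY_carrier[OF alg Y] HomY_d_def
    by (auto simp: add_diff_eq
      intro!: restrict_vhom lin_map_minus_map lin_map_smult_map LY lin_map_compose[OF hl[OF f] bl])
  show "HomY_d A Y q n (f \<oplus>\<^bsub>HomY A Y n\<^esub> g) =
      HomY_d A Y q n f \<oplus>\<^bsub>HomY A Y (n - 1)\<^esub> HomY_d A Y q n g"
    if g: "g \<in> carrier (HomY A Y n)" for g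
    using b1[OF f] b1[OF g] b2[OF f] b2[OF g] hc[OF f] hc[OF g] sc bc
    by (auto simp: HomY_ops[OF alg Y] HomY_d_def fun_eq_iff lin_map_add[OF bl] add_diff_eq diff_add_eq
        minus_add_minus[OF LY] module.smult_r_distr[OF LY, simplified])
  show "HomY_d A Y q n (c \<odot>\<^bsub>HomY A Y n\<^esub> f) = c \<odot>\<^bsub>HomY A Y (n - 1)\<^esub> HomY_d A Y q n f" for c
    using b1[OF f] b2[OF f] hc[OF f] sc bc
    by (auto simp: HomY_ops[OF alg Y] HomY_d_def fun_eq_iff lin_map_smult[OF bl] add_diff_eq diff_add_eq
        smult_minus[OF LY] intro!: arg_cong2[where f = "a_minus _"] smult_commute[OF LY])
qed

lemma HomY_der_lin: "lin_map (HomY A Y n) (HomY A Y n) (HomY_der A D Y n)"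
proof (rule lin_mapI)
  note LY = cvs_LY[OF alg Y] and hl = HomY_lin[OF alg Y] and hc = HomY_closed[OF alg Y]
  note ll = LY_der_lin[OF alg Y D]
  note lc = lin_map_closed[OF ll]
  fix f assume f: "f \<in> carrier (HomY A Y n)"
  show "HomY_der A D Y n f \<in> carrier (HomY A Y n)"
    unfolding HomY_carrier[OF alg Y] HomY_der_def
    by (auto intro!: restrict_vhom lin_map_minus_map LY lin_map_compose[OF hl[OF f] ll]
      lin_map_compose[OF ll hl[OF f]])
  show "HomY_der A D Y n (f \<oplus>\<^bsub>HomY A Y n\<^esub> g) =
      HomY_der A D Y n f \<oplus>\<^bsub>HomY A Y n\<^esub> HomY_der A D Y n g"
    if g: "g \<in> carrier (HomY A Y n)" for g
    using hc[OF f] hc[OF g] lc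
    by (auto simp: HomY_ops[OF alg Y] HomY_der_def fun_eq_iff lin_map_add[OF ll] minus_add_minus[OF LY])
  show "HomY_der A D Y n (c \<odot>\<^bsub>HomY A Y n\<^esub> f) = c \<odot>\<^bsub>HomY A Y n\<^esub> HomY_der A D Y n f" for c
    using hc[OF f] lc
    by (auto simp: HomY_ops[OF alg Y] HomY_der_def fun_eq_iff lin_map_smult[OF ll] smult_minus[OF LY])
qed

text \<open>With \<open>b L = L b\<close>, both sides evaluate to
  \<open>(L b f - b f L) - q\<^sup>n (L f b - f b L)\<close>; the four terms are only regrouped.\<close>

lemma HomY_der_d:
  assumes f: "f \<in> carrier (HomY A Y n)"
  shows "HomY_der A D Y (n - 1) (HomY_d A Y q n f) = HomY_d A Y q n (HomY_der A D Y n f)"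
proof (intro ext)
  note LY = cvs_LY[OF alg Y] and hl = HomY_lin[OF alg Y f] and hc = HomY_closed[OF alg Y f]
  note bl = LY_b_lin[OF alg Y, of _ q] and ll = LY_der_lin[OF alg Y D]
  note bc = lin_map_closed[OF bl] and lc = lin_map_closed[OF ll]
  note Lb = LY_b_der[OF alg Y D, of _ _ q]
  fix i x
  let ?L = "LY_der A D Y" and ?b = "LY_b A Y q" and ?V = "LY A Y (i + n - 1)"
  show "HomY_der A D Y (n - 1) (HomY_d A Y q n f) i x = HomY_d A Y q n (HomY_der A D Y n f) i x"
  proof (cases "x \<in> carrier (LY A Y i)")
    case x: True
    define c where "c = q powi n"
    have fb: "f (i - 1) y \<in> carrier ?V" if "y \<in> carrier (LY A Y (i - 1))" for y
      using hc[OF that] by (simp add: diff_add_eq)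
    have sc: "c \<odot>\<^bsub>?V\<^esub> y \<in> carrier ?V" if "y \<in> carrier ?V" for y
      using module.smult_closed[OF LY] that by simp
    have "HomY_der A D Y (n - 1) (HomY_d A Y q n f) i x =
        ?L (i + n - 1) (?b (i + n) (f i x) \<ominus>\<^bsub>?V\<^esub> c \<odot>\<^bsub>?V\<^esub> f (i - 1) (?b i x)) \<ominus>\<^bsub>?V\<^esub>
        (?b (i + n) (f i (?L i x)) \<ominus>\<^bsub>?V\<^esub> c \<odot>\<^bsub>?V\<^esub> f (i - 1) (?b i (?L i x)))"
      using x lc[OF x] by (simp add: HomY_der_def HomY_d_def add_diff_eq c_def)
    also have "\<dots> = (?L (i + n - 1) (?b (i + n) (f i x)) \<ominus>\<^bsub>?V\<^esub> c \<odot>\<^bsub>?V\<^esub> ?L (i + n - 1) (f (i - 1) (?b i x))) \<ominus>\<^bsub>?V\<^esub>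
        (?b (i + n) (f i (?L i x)) \<ominus>\<^bsub>?V\<^esub> c \<odot>\<^bsub>?V\<^esub> f (i - 1) (?b i (?L i x)))"
      using x by (simp add: lin_map_minus[OF LY LY ll] lin_map_smult[OF ll] hc bc fb sc)
    also have "\<dots> = (?L (i + n - 1) (?b (i + n) (f i x)) \<ominus>\<^bsub>?V\<^esub> ?b (i + n) (f i (?L i x))) \<ominus>\<^bsub>?V\<^esub>
        (c \<odot>\<^bsub>?V\<^esub> ?L (i + n - 1) (f (i - 1) (?b i x)) \<ominus>\<^bsub>?V\<^esub> c \<odot>\<^bsub>?V\<^esub> f (i - 1) (?b i (?L i x)))"
      using x by (intro minus_minus_minus[OF LY] sc lc bc hc fb)
    also have "\<dots> = ?b (i + n) (?L (i + n) (f i x) \<ominus>\<^bsub>LY A Y (i + n)\<^esub> f i (?L i x)) \<ominus>\<^bsub>?V\<^esub>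
        c \<odot>\<^bsub>?V\<^esub> (?L (i + n - 1) (f (i - 1) (?b i x)) \<ominus>\<^bsub>?V\<^esub> f (i - 1) (?L (i - 1) (?b i x)))"
      using x by (simp add: lin_map_minus[OF LY LY bl] Lb smult_minus[OF LY] hc bc lc fb)
    also have "\<dots> = HomY_d A Y q n (HomY_der A D Y n f) i x"
      using x bc[OF x] by (simp add: HomY_der_def HomY_d_def diff_add_eq c_def)
    finally show ?thesis .
  qed (simp add: HomY_der_def HomY_d_def)
qed

lemma complex_endo_HomY: "complex_endo (HomY A Y) (HomY_d A Y q) (HomY_der A D Y)"
  by (rule complex_endo.intro)
    (rule cvs_HomY[OF alg Y] HomY_d_lin HomY_der_lin HomY_der_d; assumption?)+

end

theorem theorem1p4:
  fixes A :: "(complex, 'a) module" and Y :: "'t simplicial_pset"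
    and N :: nat and q :: complex and D :: "'a \<Rightarrow> 'a"
  assumes "algebra complex_field A"
    and "pointed_simplicial_finite_set Y"
    and "N \<ge> 2" and "primitive_root_of_unity N q"
    and "is_derivation A D"
  shows "\<forall>n :: int.
    (\<forall>i\<in>{1..<N}.
       HomY_der A D Y (- n) ` cycles (HomY A Y) (HomY_d A Y q) i (- n)
         \<subseteq> cycles (HomY A Y) (HomY_d A Y q) i (- n) \<and>
       HomY_der A D Y (- n) ` boundaries N (HomY A Y) (HomY_d A Y q) i (- n)
         \<subseteq> boundaries N (HomY A Y) (HomY_d A Y q) i (- n)) \<and>
    (\<exists>!F. F \<in> vhom (HHY A Y N q n) (HHY A Y N q n) \<and>
       (\<forall>z \<in> (\<Pi>\<^sub>E i\<in>{1..<N}. cycles (HomY A Y) (HomY_d A Y q) i (- n)).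
          F (\<lambda>i\<in>{1..<N}. homology_class N (HomY A Y) (HomY_d A Y q) i (- n) (z i)) =
          (\<lambda>i\<in>{1..<N}. homology_class N (HomY A Y) (HomY_d A Y q) i (- n)
             (HomY_der A D Y (- n) (z i)))))"
proof -
  interpret complex_endo "HomY A Y" "HomY_d A Y q" "HomY_der A D Y"
    by (rule complex_endo_HomY[OF assms(1,2,5)])
  show ?thesis
    unfolding HHY_def
    by (intro allI conjI ballI cycles_subset boundaries_subset induced_map_on_homology)
qed

end
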